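(* The map sending a topograph to its river sequence (as a binary word with $L=0$, $R=1$) is a bijection from the set of primitive integer topographs of square discriminant $D\ge4$ (all such discriminants together) to the set of all finite binary words (including the empty word).
   Context: A topograph is a tree drawn in the plane with all vertices of degree 3 whose regions are labelled by integers such that for every edge, if $s,t$ label the regions on either side of it and $r,u$ the other regions at its two endpoints, then $r+u=2(s+t)$; the edge directed from the $r$-end to the $u$-end gets label $s+t-r$. A configuration $[a,b,c]$ is a directed edge with label $b$, region $a$ on its left and $c$ on its right; $b^2-4ac$ is constant on the topograph (its discriminant). Two topographs are identified if there is an orientation-preserving, label-preserving isomorphism between them. Primitive means the gcd of the region labels is $1$. A primitive topograph of discriminant $m^2\ge4$ has exactly two regions labelled $0$ (lakes), which are not adjacent, and the edges separating a positively labelled region from a negatively labelled region form a simple path (the river) of at least one edge joining the two lakes. River sequence: traverse the river from one lake to the other in the direction keeping the positive regions on the left; at each interior vertex of the river record $L$ if the next river edge has the same left (positive) region as the previous one and $R$ if it has the same right (negative) region. (If the river has one edge, the river sequence is the empty word.) *)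

theory Defs
  imports "Graph_Theory.Graph_Theory" "HOL-Combinatorics.Orbits"
begin

text \<open>
  Undirected graphs are symmetric loop-free digraphs whose arcs are pairs of vertices; the two
  directions of an edge are \<open>d\<close> and \<open>prod.swap d\<close>. In this encoding \<open>u, v, u\<close> counts as a
  \<open>cycle\<close> in the sense of \<open>Graph_Theory\<close> (so that \<open>Digraph_Component.tree\<close> is of no use here);
  the undirected cycles are exactly the ones of length at least 3.
\<close>

definition cubic_tree :: "'v pair_pre_digraph \<Rightarrow> bool" where
  "cubic_tree G \<longleftrightarrow>
     pair_bidirected_digraph G \<and>
     connected (with_proj G) \<and>
     (\<forall>p. pre_digraph.cycle (with_proj G) p \<longrightarrow> length p < 3) \<and>
     (\<forall>v\<in>pverts G. out_degree (with_proj G) v = 3)"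

text \<open>
  The drawing in the plane is recorded, up to orientation-preserving homeomorphism, by the cyclic
  order of the edges around each vertex: \<open>cw T d\<close> is the arc following \<open>d\<close> in clockwise order among
  the arcs with the same tail. A region is represented by the set of arcs that have it on their
  left; values of \<open>cw\<close> and \<open>label\<close> outside the arcs and the regions are irrelevant.
\<close>

record 'v topograph =
  skel :: "'v pair_pre_digraph"
  cw :: "'v \<times> 'v \<Rightarrow> 'v \<times> 'v"
  label :: "('v \<times> 'v) set \<Rightarrow> int"

abbreviation darts :: "'v topograph \<Rightarrow> ('v \<times> 'v) set" where
  "darts T \<equiv> parcs (skel T)"

definition plane_cubic_tree :: "'v topograph \<Rightarrow> bool" where
  "plane_cubic_tree T \<longleftrightarrow>
     cubic_tree (skel T) \<and>
     (\<forall>v\<in>pverts (skel T). cyclic_on (cw T) (out_arcs (with_proj (skel T)) v))"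

text \<open>
  Arriving at the head of \<open>d\<close>, the arc \<open>left_next T d\<close> is the turn that keeps the region on the
  left of \<open>d\<close> on the left, and \<open>right_next T d\<close> the one that keeps the region on the right.
\<close>

definition left_next :: "'v topograph \<Rightarrow> 'v \<times> 'v \<Rightarrow> 'v \<times> 'v" where
  "left_next T d = cw T (prod.swap d)"

definition right_next :: "'v topograph \<Rightarrow> 'v \<times> 'v \<Rightarrow> 'v \<times> 'v" where
  "right_next T d = cw T (cw T (prod.swap d))"

text \<open>
  The boundary of a region is a two-way infinite path, so the closure has to be taken under
  \<open>left_next\<close> and its inverse.
\<close>

definition left_region :: "'v topograph \<Rightarrow> 'v \<times> 'v \<Rightarrow> ('v \<times> 'v) set" where
  "left_region T d =
     (let R = {(e, left_next T e) | e. e \<in> darts T} in (R \<union> R\<inverse>)\<^sup>* `` {d})"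

definition right_region :: "'v topograph \<Rightarrow> 'v \<times> 'v \<Rightarrow> ('v \<times> 'v) set" where
  "right_region T d = left_region T (prod.swap d)"

text \<open>The third region at the head of an arc, respectively at its tail.\<close>

definition ahead_region :: "'v topograph \<Rightarrow> 'v \<times> 'v \<Rightarrow> ('v \<times> 'v) set" where
  "ahead_region T d = left_region T (right_next T d)"

definition behind_region :: "'v topograph \<Rightarrow> 'v \<times> 'v \<Rightarrow> ('v \<times> 'v) set" where
  "behind_region T d = ahead_region T (prod.swap d)"

definition regions :: "'v topograph \<Rightarrow> ('v \<times> 'v) set set" where
  "regions T = left_region T ` darts T"

definition is_topograph :: "'v topograph \<Rightarrow> bool" where
  "is_topograph T \<longleftrightarrow>
     plane_cubic_tree T \<and>
     (\<forall>d\<in>darts T.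
        label T (behind_region T d) + label T (ahead_region T d) =
        2 * (label T (left_region T d) + label T (right_region T d)))"

definition edge_label :: "'v topograph \<Rightarrow> 'v \<times> 'v \<Rightarrow> int" where
  "edge_label T d =
     label T (left_region T d) + label T (right_region T d) - label T (behind_region T d)"

definition has_discriminant :: "'v topograph \<Rightarrow> int \<Rightarrow> bool" where
  "has_discriminant T D \<longleftrightarrow>
     (\<forall>d\<in>darts T.
        (edge_label T d)\<^sup>2 - 4 * label T (left_region T d) * label T (right_region T d) = D)"

definition primitive_topograph :: "'v topograph \<Rightarrow> bool" where
  "primitive_topograph T \<longleftrightarrow> is_topograph T \<and> Gcd (label T ` regions T) = 1"

definition topograph_iso :: "'v topograph \<Rightarrow> 'w topograph \<Rightarrow> bool" where
  "topograph_iso S T \<longleftrightarrow> (\<exists>f.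
     bij_betw f (pverts (skel S)) (pverts (skel T)) \<and>
     map_prod f f ` darts S = darts T \<and>
     (\<forall>d\<in>darts S. cw T (map_prod f f d) = map_prod f f (cw S d)) \<and>
     (\<forall>R\<in>regions S. label T (map_prod f f ` R) = label S R))"

text \<open>
  The edges of the river, each in the direction that has the positive region on its left.
\<close>

definition river_darts :: "'v topograph \<Rightarrow> ('v \<times> 'v) set" where
  "river_darts T =
     {d \<in> darts T. label T (left_region T d) > 0 \<and> label T (right_region T d) < 0}"

definition river_path :: "'v topograph \<Rightarrow> ('v \<times> 'v) list \<Rightarrow> bool" where
  "river_path T ds \<longleftrightarrow>
     ds \<noteq> [] \<and>
     (\<exists>u v. pre_digraph.apath (with_proj (skel T)) u ds v) \<and>
     set ds = river_darts T \<and>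
     label T (behind_region T (hd ds)) = 0 \<and>
     label T (ahead_region T (last ds)) = 0 \<and>
     behind_region T (hd ds) \<noteq> ahead_region T (last ds)"

text \<open>Words over \<open>{0, 1}\<close>, with 0 standing for \<open>L\<close> and 1 for \<open>R\<close>.\<close>

definition is_river_sequence :: "'v topograph \<Rightarrow> nat list \<Rightarrow> bool" where
  "is_river_sequence T w \<longleftrightarrow> (\<exists>ds. river_path T ds \<and> length ds = Suc (length w) \<and>
     (\<forall>i<length w.
        w ! i = 0 \<and> left_region T (ds ! Suc i) = left_region T (ds ! i) \<or>
        w ! i = 1 \<and> right_region T (ds ! Suc i) = right_region T (ds ! i)))"

definition river_sequence :: "'v topograph \<Rightarrow> nat list" where
  "river_sequence T = (THE w. is_river_sequence T w)"

definition square_topographs :: "'v topograph set" where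
  "square_topographs =
     {T. primitive_topograph T \<and> (\<exists>D m. has_discriminant T D \<and> D = m\<^sup>2 \<and> D \<ge> 4)}"

definition square_topograph_iso :: "('v topograph \<times> 'v topograph) set" where
  "square_topograph_iso =
     {(S, T). S \<in> square_topographs \<and> T \<in> square_topographs \<and> topograph_iso S T}"

end

theory Submission
  imports Defs
begin

text \<open>
  In a plane cubic tree reversal of darts and clockwise rotation satisfy no relations except
  that they have orders 2 and 3. Hence a topograph is determined up to isomorphism by the
  configuration \<open>[a, b, c]\<close> at one dart, and every triple of integers occurs. The word \<open>w\<close> of
  turns along the river corresponds to a pair of coprime positive integers \<open>(p, q)\<close> by the
  Euclidean algorithm. If the first river dart is \<open>[a, b, c]\<close>, the lake behind it gives
  \<open>b = a + c\<close>, and the lake ahead of the last one gives \<open>(p + q) (a p + c q) = 0\<close>; for a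
  primitive topograph this means \<open>a = q\<close>, \<open>c = - p\<close>. Conversely this configuration has
  discriminant \<open>(p + q)\<^sup>2\<close> and its river sequence is \<open>w\<close>.
\<close>

section \<open>Walks in plane cubic trees\<close>

text \<open>A triple \<open>(a, b, c)\<close> is best read as the quadratic form
  \<open>a x^2 + b x y + c y^2\<close>: the regions left, right, ahead and behind a dart carry its
  values at \<open>(1, 0)\<close>, \<open>(0, 1)\<close>, \<open>(1, 1)\<close> and
  \<open>(1, - 1)\<close>, and every move is a unimodular substitution. A lake is a primitive zero
  of the form, which a square discriminant supplies by the quadratic formula. Along the shore of a
  lake the labels form an arithmetic progression whose difference \<open>b\<close> satisfies
  \<open>b^2 = D\<close>; for \<open>D >= 4\<close> primitivity keeps 0 out of it, and a river
  starts where it changes sign. That no other edge belongs to the river rests on monotonicity: once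
  all three entries of a configuration are nonnegative, or all nonpositive, they stay so in the
  whole half-tree ahead. The combinatorial obstacle is to define maps on darts at all: they are
  built along walks without U-turns, and only the absence of cycles makes them well defined.\<close>

locale plane_tree =
  fixes T :: "'v topograph"
  assumes plane: "plane_cubic_tree T"

sublocale plane_tree \<subseteq> pair_bidirected_digraph "skel T"
  using plane by (simp add: plane_cubic_tree_def cubic_tree_def)

context plane_tree
begin

lemma acyclic: "cycle p \<Longrightarrow> length p < 3"
  using plane by (auto simp: plane_cubic_tree_def cubic_tree_def)

lemma swap_dart [simp]: "prod.swap d \<in> darts T \<longleftrightarrow> d \<in> darts T"
  by (cases d) (auto dest: arcs_symmetric)

lemma dart_not_loop: "d \<in> darts T \<Longrightarrow> fst d \<noteq> snd d"
  by (rule no_loops)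

lemma cyclic_out_arcs:
  assumes "d \<in> darts T"
  shows "cyclic_on (cw T) {e \<in> darts T. fst e = fst d}"
    and "card {e \<in> darts T. fst e = fst d} = 3"
  using plane assms arc_fst_in_verts[of d]
  by (auto simp: plane_cubic_tree_def cubic_tree_def out_arcs_def out_degree_def)

lemma cw_dart [simp]:
  assumes "d \<in> darts T"
  shows "cw T d \<in> darts T" "fst (cw T d) = fst d"
  using cyclic_on_inI[OF cyclic_out_arcs(1)[OF assms], of d] assms by auto

lemma funpow_cw_dart [simp]:
  assumes "d \<in> darts T"
  shows "(cw T ^^ k) d \<in> darts T" "fst ((cw T ^^ k) d) = fst d"
  using assms by (induction k) auto

lemma orbit_cw: "d \<in> darts T \<Longrightarrow> orbit (cw T) d = {e \<in> darts T. fst e = fst d}"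
  by (rule orbit_cyclic_eq3[OF cyclic_out_arcs(1)]) simp_all

text \<open>The orbit of \<open>d\<close> under \<open>cw T\<close> is the whole star of its tail,
  so the first return time equals the degree 3.\<close>

lemma cw_funpow_card:
  assumes "d \<in> darts T"
  shows "(cw T ^^ 3) d = d" "inj_on (\<lambda>k. (cw T ^^ k) d) {..<3}"
    "{e \<in> darts T. fst e = fst d} = (\<lambda>k. (cw T ^^ k) d) ` {..<3}"
proof -
  let ?S = "{e \<in> darts T. fst e = fst d}"
  have orb: "orbit (cw T) d = ?S" and self: "d \<in> orbit (cw T) d"
    using orbit_cw[OF assms] assms by auto
  have least: "(cw T ^^ funpow_dist1 (cw T) d d) d = d"
    using self by (rule funpow_dist1_prop)
  have "bij_betw (\<lambda>k. (cw T ^^ k) d) {0..<funpow_dist1 (cw T) d d} (orbit (cw T) d)"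
    unfolding bij_betw_def
    using orbit_conv_funpow_dist1[OF self] inj_on_funpow_dist1[OF self] by simp
  moreover from this have "funpow_dist1 (cw T) d d = 3"
    using bij_betw_same_card cyclic_out_arcs(2)[OF assms] orb by fastforce
  ultimately have *: "bij_betw (\<lambda>k. (cw T ^^ k) d) {0..<3} ?S" "(cw T ^^ 3) d = d"
    using orb least by simp_all
  from *(2) show "(cw T ^^ 3) d = d" .
  from *(1) show "inj_on (\<lambda>k. (cw T ^^ k) d) {..<3}" "?S = (\<lambda>k. (cw T ^^ k) d) ` {..<3}"
    by (simp_all add: bij_betw_def atLeast0LessThan)
qed

lemma cw_cw_cw [simp]: "d \<in> darts T \<Longrightarrow> cw T (cw T (cw T d)) = d"
  using cw_funpow_card(1)[of d] by (simp add: numeral_3_eq_3)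

lemma cw_neq:
  assumes "d \<in> darts T"
  shows "cw T d \<noteq> d" "cw T (cw T d) \<noteq> d"
  using cw_funpow_card(2)[OF assms, THEN inj_onD, of 1 0]
    cw_funpow_card(2)[OF assms, THEN inj_onD, of 2 0]
  by (auto simp: numeral_2_eq_2)

lemma out_dart_cases:
  assumes "d \<in> darts T" "e \<in> darts T" "fst e = fst d"
  obtains "e = d" | "e = cw T d" | "e = cw T (cw T d)"
proof -
  have "e \<in> (\<lambda>k. (cw T ^^ k) d) ` {..<3}"
    using cw_funpow_card(3)[OF assms(1)] assms by auto
  then show thesis using that
    by (auto simp: numeral_3_eq_3 lessThan_Suc)
qed

text \<open>Connectedness carries a property from vertex to vertex by reversal, and cyclicity of
  \<open>cw T\<close> spreads it over each star. This is transitivity of the action of the two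
  moves.\<close>

lemma dart_induct [consumes 2, case_names base swap cw]:
  assumes "d \<in> darts T" "d0 \<in> darts T" "P d0"
    and P_swap: "\<And>d. d \<in> darts T \<Longrightarrow> P d \<Longrightarrow> P (prod.swap d)"
    and P_cw: "\<And>d. d \<in> darts T \<Longrightarrow> P d \<Longrightarrow> P (cw T d)"
  shows "P d"
proof -
  have star: "P e" if "e' \<in> darts T" "P e'" "e \<in> darts T" "fst e = fst e'" for e e'
    using out_dart_cases[OF that(1,3,4)] that P_cw by (metis cw_dart(1))
  have "connected (with_proj (skel T))"
    using plane by (simp add: plane_cubic_tree_def cubic_tree_def)
  then have "strongly_connected (with_proj (skel T))"
    using pair_sym_arcs symmetric_connected_imp_strongly_connected by blast
  then have "fst d0 \<rightarrow>\<^sup>*\<^bsub>with_proj (skel T)\<^esub> fst d"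
    using assms by (auto simp: strongly_connected_def arc_fst_in_verts)
  then have "\<forall>e \<in> darts T. fst e = fst d \<longrightarrow> P e"
  proof (induction rule: reachable_induct)
    case base
    then show ?case using star[OF assms(2,3)] by blast
  next
    case (step u v)
    then have uv: "(u, v) \<in> darts T" "P (u, v)" by auto
    from P_swap[OF this] have "P (v, u)" by simp
    with uv(1) star[of "(v, u)"] show ?case by (auto dest: arcs_symmetric)
  qed
  with assms(1) show ?thesis by blast
qed

lemma left_next_dart [simp]: "d \<in> darts T \<Longrightarrow> left_next T d \<in> darts T"
  and right_next_dart [simp]: "d \<in> darts T \<Longrightarrow> right_next T d \<in> darts T"
  by (simp_all add: left_next_def right_next_def)

text \<open>Continuation without a U-turn. Backtracking has to be ruled out explicitly, since
  \<open>u, v, u\<close> is a closed walk in every tree with an edge.\<close>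

definition turns :: "'v \<times> 'v \<Rightarrow> 'v \<times> 'v \<Rightarrow> bool" where
  "turns d e \<longleftrightarrow> fst e = snd d \<and> e \<noteq> prod.swap d"

lemma turns_iff:
  assumes "d \<in> darts T" "e \<in> darts T"
  shows "turns d e \<longleftrightarrow> e = left_next T d \<or> e = right_next T d"
proof -
  have sw: "prod.swap d \<in> darts T" using assms by simp
  show ?thesis
    using out_dart_cases[OF sw assms(2)] cw_neq[OF sw] sw
    by (auto simp: turns_def left_next_def right_next_def)
qed

definition walk :: "('v \<times> 'v) list \<Rightarrow> bool" where
  "walk ds \<longleftrightarrow> ds \<noteq> [] \<and> set ds \<subseteq> darts T \<and> successively turns ds"

lemma walk_Cons:
  "walk (d # ds) \<longleftrightarrow> d \<in> darts T \<and> (ds = [] \<or> walk ds \<and> turns d (hd ds))"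
  by (auto simp: walk_def successively_Cons)

lemma walk_appendD:
  assumes "walk (xs @ ys)"
  shows "xs \<noteq> [] \<Longrightarrow> walk xs" "ys \<noteq> [] \<Longrightarrow> walk ys"
  using assms by (auto simp: walk_def successively_append_iff)

lemma walk_awalk: "walk ds \<Longrightarrow> awalk (fst (hd ds)) ds (snd (last ds))"
proof (induction ds)
  case (Cons d ds)
  then show ?case
    by (cases "ds = []")
      (auto simp: walk_Cons turns_def awalk_Cons_iff awalk_Nil_iff arc_snd_in_verts)
qed (simp add: walk_def)

lemma walk_verts: "walk ds \<Longrightarrow> pawalk_verts u ds = fst (hd ds) # map snd ds"
  using walk_awalk[of ds] awalk_verts_conv'[of "fst (hd ds)" ds]
  by (cases ds) (auto simp: walk_def awalk_def)

text \<open>A shortest closed walk has distinct heads, since a repeated head cuts out a shorter one.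
  It is then a \<open>cycle\<close>, so it has length 1 or 2 and is a loop or contains a
  U-turn.\<close>

theorem walk_not_closed: "walk ds \<Longrightarrow> fst (hd ds) \<noteq> snd (last ds)"
proof (induction "length ds" arbitrary: ds rule: less_induct)
  case less
  show ?case
  proof
    assume closed: "fst (hd ds) = snd (last ds)"
    have "distinct (map snd ds)"
    proof (rule ccontr)
      assume "\<not> distinct (map snd ds)"
      then obtain xs ys zs y where "map snd ds = xs @ y # ys @ y # zs"
        using not_distinct_decomp[of "map snd ds"] by auto
      then obtain A D' where A: "ds = A @ D'" "y # ys @ y # zs = map snd D'"
        using map_eq_append_conv[of snd ds xs "y # ys @ y # zs"] by metis
      then obtain d D where D: "D' = d # D" "snd d = y" "ys @ y # zs = map snd D"
        by (cases D') auto
      then obtain B E where B: "D = B @ E" "y # zs = map snd E"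
        using map_eq_append_conv[of snd D ys "y # zs"] by auto
      then obtain e C where C: "E = e # C" "snd e = y"
        by (cases E) auto
      have ds: "ds = A @ d # B @ e # C" and "snd d = snd e"
        using A D B C by simp_all
      \<comment> \<open>The piece after \<open>d\<close> up to \<open>e\<close> is closed, and it is
        strictly shorter because \<open>d\<close> is dropped.\<close>
      have "walk (d # B @ [e])" "walk (B @ [e])"
        using less.prems walk_appendD(2)[of A "d # B @ e # C"]
          walk_appendD(1)[of "d # B @ [e]" C] walk_appendD(2)[of "[d]" "B @ [e]"]
        by (auto simp: ds)
      moreover from this have "fst (hd (B @ [e])) = snd d"
        by (auto simp: walk_Cons turns_def)
      ultimately show False
        using less.hyps[of "B @ [e]"] \<open>snd d = snd e\<close> by (simp add: ds)
    qed
    with closed less.prems have "cycle ds"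
      using walk_awalk[of ds] walk_verts[of ds] by (auto simp: cycle_def walk_def)
    then have "length ds < 3" by (rule acyclic)
    moreover have "ds \<noteq> []" using less.prems by (simp add: walk_def)
    ultimately consider d where "ds = [d]" | d e where "ds = [d, e]"
      by (cases ds rule: remdups_adj.cases) auto
    then show False
      using closed less.prems dart_not_loop
      by cases (auto simp: walk_def turns_def prod_eq_iff)
  qed
qed

text \<open>If the last head had occurred before, the part of the walk since then would be
  closed.\<close>

lemma walk_apath:
  assumes "walk ds"
  shows "apath (fst (hd ds)) ds (snd (last ds))"
proof -
  have "distinct (fst (hd ds) # map snd ds)" using assms
  proof (induction ds rule: rev_induct)
    case (snoc d ds)
    have closed: "fst (hd (as @ [d])) \<noteq> snd d" if "walk (as @ [d])" for as
      using walk_not_closed[OF that] by simp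
    have "snd d \<notin> snd ` set ds"
    proof
      assume "snd d \<in> snd ` set ds"
      then obtain e A B where "ds = A @ e # B" "snd e = snd d"
        by (metis (no_types, lifting) imageE split_list)
      with snoc.prems have w: "walk (e # B @ [d])"
        using walk_appendD(2)[of A "e # B @ [d]"] by simp
      then have "walk (B @ [d])" "turns e (hd (B @ [d]))"
        by (auto simp: walk_Cons)
      with closed[of B] \<open>snd e = snd d\<close> show False by (simp add: turns_def)
    qed
    then show ?case
      using snoc closed[of ds] walk_appendD(1)[of ds "[d]"] by (cases "ds = []") auto
  qed (simp add: walk_def)
  then show ?thesis
    using walk_awalk[OF assms] walk_verts[OF assms] by (simp add: apath_def)
qed

end

section \<open>The universal property of the darts\<close>

context plane_tree
begin

text \<open>Orients the tree away from the root \<open>v\<close>. The lemmas below show that no edge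
  gets both directions, that a vertex has at most one incoming dart, and that \<open>v\<close> has
  none.\<close>

inductive_set away :: "'v \<Rightarrow> ('v \<times> 'v) set" for v where
  root: "d \<in> darts T \<Longrightarrow> fst d = v \<Longrightarrow> d \<in> away v"
| step: "d \<in> away v \<Longrightarrow> e \<in> darts T \<Longrightarrow> turns d e \<Longrightarrow> e \<in> away v"

lemma away_dart: "d \<in> away v \<Longrightarrow> d \<in> darts T"
  by (induction rule: away.induct)

lemma away_walk:
  assumes "d \<in> away v"
  obtains ds where "walk (ds @ [d])" "fst (hd (ds @ [d])) = v"
proof -
  from assms have "\<exists>ds. walk (ds @ [d]) \<and> fst (hd (ds @ [d])) = v"
  proof induction
    case (root d)
    then show ?case by (intro exI[of _ "[]"]) (simp add: walk_def)
  next
    case (step d e)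
    then obtain ds where "walk (ds @ [d])" "fst (hd (ds @ [d])) = v" by blast
    with step.hyps show ?case
      by (intro exI[of _ "ds @ [d]"])
        (auto simp: walk_def successively_append_iff hd_append)
  qed
  with that show thesis by blast
qed

text \<open>Otherwise the walk from \<open>v\<close> through \<open>d\<close> could be continued by the reverse of the one
  through \<open>prod.swap d\<close> and would return to \<open>v\<close>.\<close>

lemma away_swap: "d \<in> away v \<Longrightarrow> prod.swap d \<notin> away v"
proof
  assume "d \<in> away v" "prod.swap d \<in> away v"
  then obtain p q where p: "walk (p @ [d])" "fst (hd (p @ [d])) = v"
    and q: "walk (q @ [prod.swap d])" "fst (hd (q @ [prod.swap d])) = v"
    by (metis away_walk)
  let ?r = "rev (map prod.swap (q @ [prod.swap d]))"
  have turns_swap: "turns (prod.swap f) (prod.swap e) \<longleftrightarrow> turns e f" for e f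
    by (cases e; cases f) (auto simp: turns_def)
  have "set ?r \<subseteq> darts T"
    using q(1) swap_dart unfolding walk_def set_rev set_map by blast
  moreover have "successively turns ?r"
    using q(1) unfolding walk_def successively_rev successively_map turns_swap by simp
  ultimately have "walk ?r" by (simp add: walk_def)
  moreover have "?r = d # rev (map prod.swap q)" by simp
  ultimately have "walk (p @ ?r)"
    using p(1) by (simp add: walk_def successively_append_iff)
  moreover have "hd (p @ ?r) = hd (p @ [d])" "last (p @ ?r) = prod.swap (hd (q @ [prod.swap d]))"
    by (cases p; simp) (cases q; simp)
  ultimately have "walk (p @ ?r)" "fst (hd (p @ ?r)) = v" "snd (last (p @ ?r)) = v"
    using p(2) q(2) by simp_all
  then show False using walk_not_closed by metis
qed

text \<open>Otherwise \<open>d\<close> could be continued along the reverse of \<open>e\<close>, and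
  the edge of \<open>e\<close> would get both directions.\<close>

lemma away_unique:
  assumes "d \<in> away v" "e \<in> away v" "snd d = snd e"
  shows "d = e"
proof (rule ccontr)
  assume "d \<noteq> e"
  then have "turns d (prod.swap e)"
    using assms(3) by (auto simp: turns_def prod_eq_iff)
  with assms have "prod.swap e \<in> away v"
    using away.step[of d v "prod.swap e"] by (auto dest: away_dart)
  with assms(2) show False using away_swap by blast
qed

lemma away_not_back: "d \<in> away v \<Longrightarrow> snd d \<noteq> v"
  using away_swap away.root[of "prod.swap d" v] away_dart by fastforce

text \<open>The graph of the map in the universal property, on the darts pointing away from the tail
  of \<open>d0\<close>. The onward darts at the head of \<open>d\<close> are the rotations of
  \<open>prod.swap d\<close> with \<open>k = 1\<close> and \<open>k = 2\<close>;
  \<open>k = 0\<close> would be a U-turn.\<close>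

inductive_set lift_away ::
    "('v \<times> 'v) \<Rightarrow> 'x \<Rightarrow> ('x \<Rightarrow> 'x) \<Rightarrow> ('x \<Rightarrow> 'x) \<Rightarrow> (('v \<times> 'v) \<times> 'x) set"
  for d0 x0 \<sigma> \<rho> where
  root: "k < 3 \<Longrightarrow> ((cw T ^^ k) d0, (\<rho> ^^ k) x0) \<in> lift_away d0 x0 \<sigma> \<rho>"
| step: "(d, x) \<in> lift_away d0 x0 \<sigma> \<rho> \<Longrightarrow> 0 < k \<Longrightarrow> k < 3 \<Longrightarrow>
    ((cw T ^^ k) (prod.swap d), (\<rho> ^^ k) (\<sigma> x)) \<in> lift_away d0 x0 \<sigma> \<rho>"

lemma funpow_cw_inj:
  "d \<in> darts T \<Longrightarrow> (cw T ^^ j) d = (cw T ^^ k) d \<Longrightarrow> j < 3 \<Longrightarrow> k < 3 \<Longrightarrow> j = k"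
  using cw_funpow_card(2)[of d] by (auto dest: inj_onD)

lemma lift_away_imp_away:
  assumes "d0 \<in> darts T" "(d, x) \<in> lift_away d0 x0 \<sigma> \<rho>"
  shows "d \<in> away (fst d0)"
  using assms(2)
proof induction
  case (root k)
  then show ?case using assms(1) by (simp add: away.root)
next
  case (step d x k)
  have d: "prod.swap d \<in> darts T" using step.IH away_dart by auto
  moreover have "(cw T ^^ k) (prod.swap d) \<noteq> prod.swap d"
    using funpow_cw_inj[OF d, of k 0] step.hyps by auto
  ultimately show ?case
    using step.IH away.step[of d _ "(cw T ^^ k) (prod.swap d)"] by (auto simp: turns_def)
qed

text \<open>Each dart has only one derivation: the tail of \<open>d0\<close> is the head of no dart
  pointing away from it, so \<open>root\<close> and \<open>step\<close> never clash; within
  \<open>step\<close> the predecessor is unique by \<open>away_unique\<close> and \<open>k\<close>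
  by \<open>funpow_cw_inj\<close>.\<close>

lemma lift_away_functional:
  assumes d0: "d0 \<in> darts T"
    and "(d, x) \<in> lift_away d0 x0 \<sigma> \<rho>" "(d, y) \<in> lift_away d0 x0 \<sigma> \<rho>"
  shows "x = y"
  using assms(2,3)
proof (induction arbitrary: y)
  case (root j)
  from root.prems show ?case
  proof cases
    case (root k)
    then show ?thesis using funpow_cw_inj[OF d0, of j k] \<open>j < 3\<close> by auto
  next
    case (step e z k)
    then have e: "e \<in> away (fst d0)" using lift_away_imp_away[OF d0] by fast
    then have "fst ((cw T ^^ k) (prod.swap e)) = snd e" using away_dart by simp
    moreover have "fst ((cw T ^^ j) d0) = fst d0" using d0 by simp
    ultimately show ?thesis using away_not_back[OF e] step(1) by simp
  qed
next
  case (step d x j)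
  have d: "d \<in> away (fst d0)" using lift_away_imp_away[OF d0 step.hyps(1)] .
  have fst_d: "fst ((cw T ^^ j) (prod.swap d)) = snd d" using away_dart[OF d] by simp
  note IH = step.IH and j = \<open>j < 3\<close>
  from step.prems show ?case
  proof cases
    case (root k)
    then show ?thesis using fst_d d0 away_not_back[OF d] by simp
  next
    case (step e z k)
    have e: "e \<in> away (fst d0)" using lift_away_imp_away[OF d0 step(3)] .
    have "fst ((cw T ^^ k) (prod.swap e)) = snd e" using away_dart[OF e] by simp
    then have "snd d = snd e" using fst_d step(1) by metis
    then have \<open>d = e\<close> by (rule away_unique[OF d e])
    moreover have "j = k"
      by (rule funpow_cw_inj[of "prod.swap d"])
        (use step(1,5) \<open>d = e\<close> j away_dart[OF d] in simp_all)
    ultimately show ?thesis using step(2) IH[OF step(3)[folded \<open>d = e\<close>]] by simp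
  qed
qed

text \<open>The darts form a free transitive action of the group generated by \<open>prod.swap\<close> of order 2
  and \<open>cw T\<close> of order 3.\<close>

theorem universal_property:
  assumes d0: "d0 \<in> darts T" and x0: "x0 \<in> X"
    and \<sigma>: "\<And>x. x \<in> X \<Longrightarrow> \<sigma> x \<in> X" "\<And>x. x \<in> X \<Longrightarrow> \<sigma> (\<sigma> x) = x"
    and \<rho>: "\<And>x. x \<in> X \<Longrightarrow> \<rho> x \<in> X" "\<And>x. x \<in> X \<Longrightarrow> \<rho> (\<rho> (\<rho> x)) = x"
  obtains h where "h d0 = x0" "\<And>d. d \<in> darts T \<Longrightarrow> h d \<in> X"
    "\<And>d. d \<in> darts T \<Longrightarrow> h (prod.swap d) = \<sigma> (h d)"
    "\<And>d. d \<in> darts T \<Longrightarrow> h (cw T d) = \<rho> (h d)"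
proof -
  define H where "H = lift_away d0 x0 \<sigma> \<rho>"
  \<comment> \<open>Darts pointing back towards the root get the value forced by
    \<open>\<sigma>\<close>; by \<open>away_swap\<close> the two clauses never compete.\<close>
  define G where "G d x \<longleftrightarrow> (d, x) \<in> H \<or> (\<exists>y. (prod.swap d, y) \<in> H \<and> x = \<sigma> y)" for d x
  have \<rho>_pow: "(\<rho> ^^ k) x \<in> X" if "x \<in> X" for k x
    using that by (induction k) (auto simp: \<rho>)
  have H_X: "x \<in> X" if "(d, x) \<in> H" for d x
    using that unfolding H_def by induction (auto simp: \<rho>_pow x0 \<sigma>)
  have G_X: "x \<in> X" if "G d x" for d x
    using that H_X \<sigma> unfolding G_def by blast
  have H_away: "d \<in> away (fst d0)" if "(d, x) \<in> H" for d x
    using lift_away_imp_away[OF d0] that unfolding H_def .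
  have H_unique: "x = y" if "(d, x) \<in> H" "(d, y) \<in> H" for d x y
    using lift_away_functional[OF d0] that unfolding H_def .
  have G_unique: "x = y" if "G d x" "G d y" for d x y
    using that away_swap[of d "fst d0"] H_unique H_away unfolding G_def by metis
  have G_swap: "G (prod.swap d) (\<sigma> x)" if "G d x" for d x
    using that \<sigma>(2) H_X unfolding G_def by (metis swap_swap)
  have H_cw: "G (cw T d) (\<rho> x)" if "(d, x) \<in> H" for d x
    using that unfolding H_def
  proof cases
    case (root k)
    show ?thesis
    \<comment> \<open>The third rotation closes up at \<open>d0\<close>, and the values agree
      because \<open>\<rho>\<close> applied three times is the identity.\<close>
    proof (cases "k = 2")
      case True
      then show ?thesis using root d0 x0 \<rho> lift_away.root[of 0 d0 \<rho> x0 \<sigma>]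
        by (simp add: numeral_2_eq_2 G_def H_def)
    next
      case False
      then show ?thesis using root lift_away.root[of "Suc k" d0 \<rho> x0 \<sigma>] by (simp add: G_def H_def)
    qed
  next
    case (step e y k)
    have e: "prod.swap e \<in> darts T" and y: "\<sigma> y \<in> X"
      using H_away[of e y] H_X[of e y] step away_dart \<sigma> by (auto simp: H_def)
    show ?thesis
    \<comment> \<open>Here the third rotation returns to \<open>prod.swap e\<close>, which the
      second clause of \<open>G\<close> covers.\<close>
    proof (cases "k = 2")
      case True
      then have "cw T d = prod.swap e" "\<rho> x = \<sigma> y"
        using step e y \<rho> by (simp_all add: numeral_2_eq_2)
      then show ?thesis using step by (auto simp: G_def H_def)
    next
      case False
      then show ?thesis using step lift_away.step[of e y d0 x0 \<sigma> \<rho> "Suc k"]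
        by (simp add: G_def H_def)
    qed
  qed
  have G_cw: "G (cw T d) (\<rho> x)" if "G d x" for d x
    using that unfolding G_def[of d]
  proof (elim disjE exE conjE)
    \<comment> \<open>From a dart pointing back, \<open>cw T\<close> leads to the first onward dart,
      hence \<open>k = 1\<close>.\<close>
    fix y assume "(prod.swap d, y) \<in> H" "x = \<sigma> y"
    then show ?thesis
      using lift_away.step[of "prod.swap d" y d0 x0 \<sigma> \<rho> 1] by (auto simp: H_def G_def)
  qed (rule H_cw)
  have "G d0 x0"
    using lift_away.root[of 0 d0 \<rho> x0 \<sigma>] by (simp add: G_def H_def)
  have "\<exists>x. G d x" if "d \<in> darts T" for d
    using that d0 by (induction rule: dart_induct) (use \<open>G d0 x0\<close> G_swap G_cw in blast)+
  then have G_the: "G d (THE x. G d x)" if "d \<in> darts T" for d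
    using that G_unique theI'[of "G d"] by blast
  show thesis
  proof
    show "(THE x. G d0 x) = x0"
      by (rule G_unique[OF G_the[OF d0] \<open>G d0 x0\<close>])
    fix d assume d: "d \<in> darts T"
    show "(THE x. G d x) \<in> X"
      by (rule G_X[OF G_the[OF d]])
    show "(THE x. G (prod.swap d) x) = \<sigma> (THE x. G d x)"
      by (rule G_unique[OF G_the G_swap[OF G_the[OF d]]]) (use d in simp)
    show "(THE x. G (cw T d) x) = \<rho> (THE x. G d x)"
      by (rule G_unique[OF G_the G_cw[OF G_the[OF d]]]) (use d in simp)
  qed
qed

end

section \<open>Regions, configurations and isomorphisms\<close>

context plane_tree
begin

lemma left_next_swap_left_next [simp]:
  "d \<in> darts T \<Longrightarrow> left_next T (prod.swap (left_next T d)) = right_next T d"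
  "d \<in> darts T \<Longrightarrow> left_next T (prod.swap (right_next T d)) = prod.swap d"
  "d \<in> darts T \<Longrightarrow> right_next T (prod.swap (left_next T d)) = prod.swap d"
  "d \<in> darts T \<Longrightarrow> right_next T (prod.swap (right_next T d)) = left_next T d"
  by (simp_all add: left_next_def right_next_def)

definition region_step :: "(('v \<times> 'v) \<times> ('v \<times> 'v)) set" where
  "region_step = {(e, left_next T e) | e. e \<in> darts T}"

lemma left_region_altdef: "left_region T d = (region_step \<union> region_step\<inverse>)\<^sup>* `` {d}"
  unfolding left_region_def region_step_def Let_def ..

lemma left_region_self: "d \<in> left_region T d"
  by (simp add: left_region_altdef)

lemma left_region_eqI: "e \<in> left_region T d \<Longrightarrow> left_region T e = left_region T d"
proof -
  have "sym ((region_step \<union> region_step\<inverse>)\<^sup>*)"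
    by (rule sym_rtrancl) (simp add: sym_Un_converse)
  moreover assume "e \<in> left_region T d"
  ultimately show ?thesis
    by (auto simp: left_region_altdef dest: symD intro: rtrancl_trans)
qed

lemma left_region_left_next [simp]:
  assumes "d \<in> darts T"
  shows "left_region T (left_next T d) = left_region T d"
proof (rule left_region_eqI)
  have "(d, left_next T d) \<in> region_step"
    using assms unfolding region_step_def by blast
  then show "left_next T d \<in> left_region T d"
    by (auto simp: left_region_altdef)
qed

lemma right_region_left_next [simp]:
  "d \<in> darts T \<Longrightarrow> right_region T (left_next T d) = ahead_region T d"
  using left_region_left_next[of "prod.swap (left_next T d)"]
  by (simp add: right_region_def ahead_region_def)

lemma left_region_right_next [simp]:
  "left_region T (right_next T d) = ahead_region T d"
  by (simp add: ahead_region_def)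

lemma right_region_right_next [simp]:
  "d \<in> darts T \<Longrightarrow> right_region T (right_next T d) = right_region T d"
  using left_region_left_next[of "prod.swap (right_next T d)"]
  by (simp add: right_region_def)

lemma behind_region_left_next [simp]:
  "d \<in> darts T \<Longrightarrow> behind_region T (left_next T d) = right_region T d"
  by (simp add: behind_region_def ahead_region_def right_region_def)

lemma behind_region_right_next [simp]:
  "d \<in> darts T \<Longrightarrow> behind_region T (right_next T d) = left_region T d"
  by (simp add: behind_region_def ahead_region_def)

lemma region_swap [simp]:
  "left_region T (prod.swap d) = right_region T d"
  "right_region T (prod.swap d) = left_region T d"
  "ahead_region T (prod.swap d) = behind_region T d"
  "behind_region T (prod.swap d) = ahead_region T d"
  by (simp_all add: right_region_def behind_region_def)

lemma region_invariant:
  assumes "d \<in> darts T" "e \<in> left_region T d"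
    and "\<And>d. d \<in> darts T \<Longrightarrow> f (left_next T d) = f d"
  shows "e \<in> darts T \<and> f e = f d"
proof -
  have "(d, e) \<in> (region_step \<union> region_step\<inverse>)\<^sup>*"
    using assms(2) by (simp add: left_region_altdef)
  then show ?thesis
    using assms(1,3) by induction (auto simp: region_step_def)
qed

lemma pverts_eq: "pverts (skel T) = fst ` darts T"
proof
  show "pverts (skel T) \<subseteq> fst ` darts T"
  proof
    fix v assume "v \<in> pverts (skel T)"
    then have "cyclic_on (cw T) (out_arcs (with_proj (skel T)) v)"
      using plane by (simp add: plane_cubic_tree_def)
    then obtain d where "d \<in> out_arcs (with_proj (skel T)) v"
      unfolding cyclic_on_def by blast
    then show "v \<in> fst ` darts T" by (auto simp: out_arcs_def)
  qed
qed (use arc_fst_in_verts in blast)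

lemma left_next_surj:
  assumes "d \<in> darts T"
  obtains e where "e \<in> darts T" "left_next T e = d"
  using assms that[of "prod.swap (cw T (cw T d))"] by (simp add: left_next_def)

end

section \<open>Configurations as binary quadratic forms\<close>

type_synonym config = "int \<times> int \<times> int"

text \<open>As substitutions in \<open>a x^2 + b x y + c y^2\<close>: \<open>config_swap\<close>
  replaces \<open>(x, y)\<close> by \<open>(- y, x)\<close>, \<open>config_left\<close> by
  \<open>(x + y, y)\<close>, and \<open>config_right\<close> by \<open>(x, x + y)\<close>.\<close>

fun config_swap :: "config \<Rightarrow> config" where
  "config_swap (a, b, c) = (c, - b, a)"

fun config_left :: "config \<Rightarrow> config" where
  "config_left (a, b, c) = (a, 2 * a + b, a + b + c)"

fun config_right :: "config \<Rightarrow> config" where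
  "config_right (a, b, c) = (a + b + c, b + 2 * c, c)"

text \<open>Forced by \<open>left_next T d = cw T (prod.swap d)\<close>.\<close>

definition config_cw :: "config \<Rightarrow> config" where
  "config_cw s = config_left (config_swap s)"

lemma config_swap_swap [simp]: "config_swap (config_swap s) = s"
  by (cases s) simp

lemma config_cw_cw_cw: "config_cw (config_cw (config_cw s)) = s"
  by (cases s) (simp add: config_cw_def)

lemma config_left_conv_cw: "config_left s = config_cw (config_swap s)"
  by (simp add: config_cw_def)

lemma config_right_conv_cw: "config_right s = config_cw (config_cw (config_swap s))"
  by (cases s) (simp add: config_cw_def)

definition config :: "'v topograph \<Rightarrow> 'v \<times> 'v \<Rightarrow> config" where
  "config T d = (label T (left_region T d), edge_label T d, label T (right_region T d))"

context plane_tree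
begin

text \<open>The universal property applied to the set of all triples. The labels of \<open>T\<close>
  do not enter, so auxiliary labellings can be put on any plane tree.\<close>

lemma config_labelling:
  assumes "d0 \<in> darts T"
  obtains h where "h d0 = s"
    "\<And>d. d \<in> darts T \<Longrightarrow> h (prod.swap d) = config_swap (h d)"
    "\<And>d. d \<in> darts T \<Longrightarrow> h (left_next T d) = config_left (h d)"
    "\<And>d. d \<in> darts T \<Longrightarrow> h (right_next T d) = config_right (h d)"
proof -
  obtain h where "h d0 = s"
    "\<And>d. d \<in> darts T \<Longrightarrow> h (prod.swap d) = config_swap (h d)"
    "\<And>d. d \<in> darts T \<Longrightarrow> h (cw T d) = config_cw (h d)"
    by (rule universal_property[OF assms, of s UNIV config_swap config_cw])
      (auto simp: config_cw_cw_cw)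
  then show thesis
    using that[of h]
    by (simp add: left_next_def right_next_def config_left_conv_cw config_right_conv_cw)
qed

text \<open>A left turn keeps the first entry, so a labelling of the darts descends to the regions.
  This serves both to tell regions apart and to construct topographs.\<close>

lemma config_labelling_region:
  assumes "d \<in> darts T" "left_region T d = left_region T e"
    and "\<And>d. d \<in> darts T \<Longrightarrow> h (left_next T d) = config_left (h d)"
  shows "fst (h d) = fst (h e)"
proof -
  have "fst (config_left s) = fst s" for s by (cases s) simp
  then have "e \<in> darts T \<and> fst (h e) = fst (h d)"
    using assms left_region_self[of e]
    by (intro region_invariant[where f = "\<lambda>d. fst (h d)"]) auto
  then show ?thesis by simp
qed

text \<open>Regions are told apart by giving the tree another labelling, in which they have different
  labels.\<close>

lemma left_ne_ahead_region:
  assumes "d \<in> darts T"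
  shows "left_region T d \<noteq> ahead_region T d"
proof
  \<comment> \<open>The form \<open>(x + y)^2\<close>, with the value 1 on the left and 4
    ahead.\<close>
  obtain h where h: "h d = (1, 2, 1)"
    "\<And>d. d \<in> darts T \<Longrightarrow> h (prod.swap d) = config_swap (h d)"
    "\<And>d. d \<in> darts T \<Longrightarrow> h (left_next T d) = config_left (h d)"
    "\<And>d. d \<in> darts T \<Longrightarrow> h (right_next T d) = config_right (h d)"
    by (rule config_labelling[OF assms, of "(1, 2, 1)"]) blast
  assume eq: "left_region T d = ahead_region T d"
  have "fst (h d) = fst (h (right_next T d))"
    by (rule config_labelling_region[where h = h, OF _ _ h(3)]) (use assms eq in simp_all)
  then show False using h(1) h(2)[OF assms] h(4)[OF assms] by simp
qed

lemma right_ne_ahead_region: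
  assumes "d \<in> darts T"
  shows "right_region T d \<noteq> ahead_region T d"
proof
  obtain h where h: "h d = (1, 2, 1)"
    "\<And>d. d \<in> darts T \<Longrightarrow> h (prod.swap d) = config_swap (h d)"
    "\<And>d. d \<in> darts T \<Longrightarrow> h (left_next T d) = config_left (h d)"
    "\<And>d. d \<in> darts T \<Longrightarrow> h (right_next T d) = config_right (h d)"
    by (rule config_labelling[OF assms, of "(1, 2, 1)"]) blast
  assume eq: "right_region T d = ahead_region T d"
  have "fst (h (prod.swap d)) = fst (h (right_next T d))"
    by (rule config_labelling_region[where h = h, OF _ _ h(3)]) (use assms eq in simp_all)
  then show False using h(1) h(2)[OF assms] h(4)[OF assms] by simp
qed

end

locale topograph_tree =
  fixes T :: "'v topograph"
  assumes topograph: "is_topograph T"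

sublocale topograph_tree \<subseteq> plane_tree
  using topograph by unfold_locales (simp add: is_topograph_def)

context topograph_tree
begin

lemma ahead_label:
  assumes "d \<in> darts T" "config T d = (a, b, c)"
  shows "label T (ahead_region T d) = a + b + c"
  using assms topograph by (auto simp: is_topograph_def config_def edge_label_def)

lemma behind_label:
  assumes "config T d = (a, b, c)"
  shows "label T (behind_region T d) = a - b + c"
  using assms by (auto simp: config_def edge_label_def)

lemma config_swap_dart [simp]:
  assumes "d \<in> darts T"
  shows "config T (prod.swap d) = config_swap (config T d)"
  using ahead_label[OF assms] by (simp add: config_def edge_label_def)

lemma config_left_next [simp]:
  assumes "d \<in> darts T"
  shows "config T (left_next T d) = config_left (config T d)"
  using ahead_label[OF assms] assms by (simp add: config_def edge_label_def)

lemma config_right_next [simp]: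
  assumes "d \<in> darts T"
  shows "config T (right_next T d) = config_right (config T d)"
  using ahead_label[OF assms] assms by (simp add: config_def edge_label_def)

lemma config_cw_dart [simp]:
  assumes "d \<in> darts T"
  shows "config T (cw T d) = config_cw (config T d)"
  using config_left_next[of "prod.swap d"] assms by (simp add: left_next_def config_cw_def)

end

section \<open>Isomorphisms and configurations\<close>

lemma left_region_image:
  assumes "plane_cubic_tree S" "plane_cubic_tree T"
    and bij: "bij_betw \<phi> (darts S) (darts T)"
    and \<phi>: "\<And>d. d \<in> darts S \<Longrightarrow> left_next T (\<phi> d) = \<phi> (left_next S d)"
    and d: "d \<in> darts S"
  shows "left_region T (\<phi> d) = \<phi> ` left_region S d"
proof -
  interpret S: plane_tree S using assms by unfold_locales
  interpret T: plane_tree T using assms by unfold_locales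
  have \<phi>_dart: "\<phi> e \<in> darts T" if "e \<in> darts S" for e
    using bij that by (auto simp: bij_betw_def)
  have inj: "e = e'" if "\<phi> e = \<phi> e'" "e \<in> darts S" "e' \<in> darts S" for e e'
    using bij that by (auto simp: bij_betw_def dest: inj_onD)
  show ?thesis
  proof (intro equalityI subsetI)
    fix e assume "e \<in> left_region T (\<phi> d)"
    then have "(\<phi> d, e) \<in> (T.region_step \<union> T.region_step\<inverse>)\<^sup>*"
      by (simp add: T.left_region_altdef)
    then have "\<exists>e'. e' \<in> darts S \<and> e = \<phi> e' \<and> left_region S e' = left_region S d"
    proof induction
      case base
      then show ?case using d by blast
    next
      case (step y z)
      then obtain y' where y': "y' \<in> darts S" "y = \<phi> y'" "left_region S y' = left_region S d"
        by blast
      from step.hyps(2) consider "z = left_next T y" | "z \<in> darts T" "y = left_next T z"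
        unfolding T.region_step_def by blast
      then show ?case
      proof cases
        case 1
        then show ?thesis using y' \<phi>[OF y'(1)] by (intro exI[of _ "left_next S y'"]) simp
      next
        case 2
        then obtain z' where z': "z' \<in> darts S" "z = \<phi> z'"
          using bij unfolding bij_betw_def by blast
        then have "\<phi> y' = \<phi> (left_next S z')"
          using 2 y' \<phi>[OF z'(1)] by simp
        \<comment> \<open>A step against \<open>left_next\<close> can be pulled back because
          \<open>\<phi>\<close> is injective.\<close>
        then have "y' = left_next S z'"
          using inj y' z' by simp
        then show ?thesis
          using z' y' S.left_region_left_next[OF z'(1)] by blast
      qed
    qed
    then show "e \<in> \<phi> ` left_region S d" using S.left_region_self by blast
  next
    fix e assume "e \<in> \<phi> ` left_region S d"
    then obtain e' where e': "e = \<phi> e'" "e' \<in> left_region S d" by blast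
    then have "(d, e') \<in> (S.region_step \<union> S.region_step\<inverse>)\<^sup>*"
      by (simp add: S.left_region_altdef)
    then have "e' \<in> darts S \<and> left_region T (\<phi> e') = left_region T (\<phi> d)"
    proof induction
      case base
      then show ?case using d by blast
    next
      case (step y z)
      from step.hyps(2) consider "z = left_next S y" | "z \<in> darts S" "y = left_next S z"
        unfolding S.region_step_def by blast
      then show ?case
      proof cases
        case 1
        have "left_region T (left_next T (\<phi> y)) = left_region T (\<phi> y)"
          using step.IH \<phi>_dart by simp
        with 1 show ?thesis using step.IH \<phi>[of y] by simp
      next
        case 2
        have "left_region T (left_next T (\<phi> z)) = left_region T (\<phi> z)"
          using 2 \<phi>_dart by simp
        with 2 show ?thesis using step.IH \<phi>[of z] by simp
      qed
    qed
    then show "e \<in> left_region T (\<phi> d)"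
      using T.left_region_self e' by blast
  qed
qed

lemma iso_imp_config:
  assumes "is_topograph S" "is_topograph T" "topograph_iso S T" "d \<in> darts S"
  obtains e where "e \<in> darts T" "config T e = config S d"
proof -
  interpret S: topograph_tree S using assms by unfold_locales
  interpret T: topograph_tree T using assms by unfold_locales
  obtain f where f: "bij_betw f (pverts (skel S)) (pverts (skel T))"
    "map_prod f f ` darts S = darts T"
    "\<And>d. d \<in> darts S \<Longrightarrow> cw T (map_prod f f d) = map_prod f f (cw S d)"
    "\<And>R. R \<in> regions S \<Longrightarrow> label T (map_prod f f ` R) = label S R"
    using assms(3) unfolding topograph_iso_def by blast
  define \<phi> where "\<phi> = map_prod f f"
  have \<phi>_dart: "\<phi> d \<in> darts T" if "d \<in> darts S" for d
    using f(2) that by (auto simp: \<phi>_def)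
  have \<phi>_swap: "prod.swap (\<phi> d) = \<phi> (prod.swap d)" for d
    by (cases d) (simp add: \<phi>_def)
  have \<phi>_inj: "inj_on \<phi> (darts S)"
    using bij_betw_imp_inj_on[OF f(1)] S.arc_fst_in_verts S.arc_snd_in_verts
    by (auto simp: \<phi>_def inj_on_def prod_eq_iff)
  have \<phi>_cw: "cw T (\<phi> d) = \<phi> (cw S d)" if "d \<in> darts S" for d
    using f(3) that by (simp add: \<phi>_def)
  have \<phi>_left: "left_next T (\<phi> d) = \<phi> (left_next S d)"
    and \<phi>_right: "right_next T (\<phi> d) = \<phi> (right_next S d)" if "d \<in> darts S" for d
    using that by (simp_all add: left_next_def right_next_def \<phi>_swap \<phi>_cw)
  have region: "left_region T (\<phi> d) = \<phi> ` left_region S d" if "d \<in> darts S" for d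
    using S.plane T.plane _ \<phi>_left that
    by (rule left_region_image) (use \<phi>_inj f(2) in \<open>simp_all add: bij_betw_def \<phi>_def\<close>)
  have lab: "label T (left_region T (\<phi> d)) = label S (left_region S d)" if "d \<in> darts S" for d
    using f(4) that by (simp add: region regions_def flip: \<phi>_def)
  have "config T (\<phi> d) = config S d"
    \<comment> \<open>The third instance concerns the region behind \<open>d\<close>, which enters
      the edge label.\<close>
    using lab[OF assms(4)] lab[of "prod.swap d"] lab[of "right_next S (prod.swap d)"] assms(4)
    by (simp add: config_def edge_label_def \<phi>_right[symmetric] \<phi>_swap[symmetric])
  then show thesis using that \<phi>_dart assms(4) by blast
qed

text \<open>The universal property in both directions gives mutually inverse maps of darts. They
  commute with rotation, so they preserve common tails and descend to vertices. Configurations agree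
  everywhere because both moves change them alike.\<close>

theorem config_eq_imp_iso:
  fixes S :: "'v topograph" and T :: "'w topograph"
  assumes "is_topograph S" "is_topograph T" "d0 \<in> darts S" "e0 \<in> darts T"
    and "config S d0 = config T e0"
  shows "topograph_iso S T"
proof -
  interpret S: topograph_tree S using assms by unfold_locales
  interpret T: topograph_tree T using assms by unfold_locales
  obtain \<phi> where \<phi>: "\<phi> d0 = e0" "\<And>d. d \<in> darts S \<Longrightarrow> \<phi> d \<in> darts T"
    "\<And>d. d \<in> darts S \<Longrightarrow> \<phi> (prod.swap d) = prod.swap (\<phi> d)"
    "\<And>d. d \<in> darts S \<Longrightarrow> \<phi> (cw S d) = cw T (\<phi> d)"
    by (rule S.universal_property[OF assms(3), of e0 "darts T" prod.swap "cw T"])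
      (use assms(4) in auto)
  obtain \<psi> where \<psi>: "\<psi> e0 = d0" "\<And>d. d \<in> darts T \<Longrightarrow> \<psi> d \<in> darts S"
    "\<And>d. d \<in> darts T \<Longrightarrow> \<psi> (prod.swap d) = prod.swap (\<psi> d)"
    "\<And>d. d \<in> darts T \<Longrightarrow> \<psi> (cw T d) = cw S (\<psi> d)"
    by (rule T.universal_property[OF assms(4), of d0 "darts S" prod.swap "cw S"])
      (use assms(3) in auto)
  have \<psi>\<phi>: "\<psi> (\<phi> d) = d" if "d \<in> darts S" for d
    using that assms(3) by (induction rule: S.dart_induct) (simp_all add: \<phi> \<psi>)
  have \<phi>\<psi>: "\<phi> (\<psi> d) = d" if "d \<in> darts T" for d
    using that assms(4) by (induction rule: T.dart_induct) (simp_all add: \<phi> \<psi>)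
  have bij: "bij_betw \<phi> (darts S) (darts T)"
    by (rule bij_betw_byWitness[where f' = \<psi>]) (use \<phi> \<psi> \<psi>\<phi> \<phi>\<psi> in blast)+
  have conf: "config T (\<phi> d) = config S d" if "d \<in> darts S" for d
    using that assms(3) by (induction rule: S.dart_induct) (simp_all add: \<phi> assms(5))
  have \<phi>_fst: "fst (\<phi> d) = fst (\<phi> e)" if "d \<in> darts S" "e \<in> darts S" "fst d = fst e" for d e
    using S.out_dart_cases[OF that(1,2)] that \<phi> by (metis S.cw_dart(1) T.cw_dart(2))
  have \<psi>_fst: "fst (\<psi> d) = fst (\<psi> e)" if "d \<in> darts T" "e \<in> darts T" "fst d = fst e" for d e
    using T.out_dart_cases[OF that(1,2)] that \<psi> by (metis T.cw_dart(1) S.cw_dart(2))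
  \<comment> \<open>Any dart at \<open>v\<close> would do: by \<open>\<phi>_fst\<close> the result
    does not depend on it.\<close>
  define f where "f v = fst (\<phi> (SOME d. d \<in> darts S \<and> fst d = v))" for v
  define g where "g v = fst (\<psi> (SOME d. d \<in> darts T \<and> fst d = v))" for v
  have f_fst: "f (fst d) = fst (\<phi> d)" if "d \<in> darts S" for d
    unfolding f_def
    using someI[of "\<lambda>e. e \<in> darts S \<and> fst e = fst d" d] that by (intro \<phi>_fst) auto
  have g_fst: "g (fst d) = fst (\<psi> d)" if "d \<in> darts T" for d
    unfolding g_def
    using someI[of "\<lambda>e. e \<in> darts T \<and> fst e = fst d" d] that by (intro \<psi>_fst) auto
  have f_prod: "map_prod f f d = \<phi> d" if "d \<in> darts S" for d
    using f_fst[OF that] f_fst[of "prod.swap d"] \<phi>(3)[OF that] that by (simp add: prod_eq_iff)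
  have "bij_betw f (pverts (skel S)) (pverts (skel T))"
    unfolding S.pverts_eq T.pverts_eq
    by (rule bij_betw_byWitness[where f' = g])
      (auto simp: f_fst g_fst \<phi> \<psi> \<phi>\<psi> \<psi>\<phi> simp del: fst_conv)
  moreover have "map_prod f f ` darts S = darts T"
  proof -
    have "map_prod f f ` darts S = \<phi> ` darts S" by (rule image_cong[OF refl f_prod])
    then show ?thesis using bij by (simp add: bij_betw_def)
  qed
  moreover have "\<forall>d\<in>darts S. cw T (map_prod f f d) = map_prod f f (cw S d)"
    by (simp add: f_prod \<phi>)
  moreover have "label T (map_prod f f ` R) = label S R" if "R \<in> regions S" for R
  proof -
    from that obtain d where d: "d \<in> darts S" "R = left_region S d"
      by (auto simp: regions_def)
    have R_darts: "e \<in> darts S" if "e \<in> R" for e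
      using S.region_invariant[OF d(1), of e "\<lambda>_. ()"] d(2) that by simp
    have "map_prod f f ` R = \<phi> ` R" using f_prod R_darts by auto
    also have "\<phi> ` R = left_region T (\<phi> d)"
      unfolding d(2)
      by (rule left_region_image[symmetric, OF S.plane T.plane bij _ d(1)])
        (simp add: left_next_def \<phi>)
    finally show ?thesis using conf[OF d(1)] d by (simp add: config_def)
  qed
  ultimately show ?thesis unfolding topograph_iso_def by blast
qed

section \<open>Words and coprime pairs\<close>

text \<open>With \<open>(p, q) = lake_vector w\<close>, the region reached from a configuration \<open>[a, b, c]\<close> by the
  turns \<open>w\<close> has the label \<open>a p\<^sup>2 + b p q + c q\<^sup>2\<close>; this is the Stern--Brocot coding of
  coprime pairs.\<close>

fun lake_vector :: "nat list \<Rightarrow> int \<times> int" where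
  "lake_vector [] = (1, 1)"
| "lake_vector (x # w) =
    (let (p, q) = lake_vector w in if x = 0 then (p + q, q) else (p, p + q))"

lemma lake_vector_pos: "lake_vector w = (p, q) \<Longrightarrow> p > 0 \<and> q > 0"
  by (induction w arbitrary: p q) (auto simp: Let_def split: prod.splits if_splits; fastforce)+

lemma coprime_lake_vector: "lake_vector w = (p, q) \<Longrightarrow> coprime p q"
proof (induction w arbitrary: p q)
  case (Cons x w)
  obtain p' q' where "lake_vector w = (p', q')" by fastforce
  with Cons show ?case
    by (auto simp: coprime_iff_gcd_eq_1 gcd_add1 gcd_add2 add.commute split: if_splits)
qed simp

text \<open>The first letter is read off by comparing the entries: \<open>p = q\<close> for the
  empty word, \<open>p > q\<close> for 0, \<open>p < q\<close> for 1.\<close>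

lemma lake_vector_inj:
  assumes "w \<in> lists {0, 1}" "w' \<in> lists {0, 1}" "lake_vector w = lake_vector w'"
  shows "w = w'"
  using assms
proof (induction w arbitrary: w' rule: list.induct)
  case Nil
  then show ?case
  proof (cases w')
    case (Cons y v)
    obtain p q where "lake_vector v = (p, q)" by fastforce
    with Nil Cons lake_vector_pos[OF this] show ?thesis by (auto split: if_splits)
  qed simp
next
  case (Cons x w)
  note IH = Cons.IH and prems = Cons.prems
  obtain p q where pq: "lake_vector w = (p, q)" by fastforce
  show ?case
  proof (cases w')
    case Nil
    with prems(3) pq lake_vector_pos[OF pq] show ?thesis by (auto split: if_splits)
  next
    case w': (Cons y v)
    obtain r s where rs: "lake_vector v = (r, s)" by fastforce
    have "(if x = 0 then (p + q, q) else (p, p + q)) = (if y = 0 then (r + s, s) else (r, r + s))"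
      using prems(3) pq rs by (simp add: w')
    moreover have "x = 0 \<or> x = 1" "y = 0 \<or> y = 1"
      using prems(1,2) by (auto simp: w')
    ultimately have "x = y \<and> p = r \<and> q = s"
      using lake_vector_pos[OF pq] lake_vector_pos[OF rs] by (auto split: if_splits)
    then show ?thesis
      using IH[of v] prems(1,2) pq rs by (simp add: w')
  qed
qed

text \<open>The subtractive Euclidean algorithm; coprimality makes it stop at
  \<open>(1, 1)\<close>.\<close>

lemma lake_vector_surj:
  assumes "coprime p q" "p > 0" "q > 0"
  obtains w where "w \<in> lists {0, 1}" "lake_vector w = (p, q)"
proof -
  have "\<exists>w\<in>lists {0, 1}. lake_vector w = (p, q)"
    using assms
  proof (induction "nat (p + q)" arbitrary: p q rule: less_induct)
    case less
    consider "p = q" | "p > q" | "p < q" by linarith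
    then show ?case
    proof cases
      case 1
      with less have "p = 1" by simp
      with 1 show ?thesis by (intro bexI[of _ "[]"]) auto
    next
      case 2
      have "coprime (p - q) q"
        using less.prems(1) by (metis coprime_iff_gcd_eq_1 gcd_diff1)
      then obtain w where "w \<in> lists {0, 1}" "lake_vector w = (p - q, q)"
        using less.hyps[of "p - q" q] less.prems 2 by auto
      then show ?thesis by (intro bexI[of _ "0 # w"]) auto
    next
      case 3
      have "coprime p (q - p)"
        using less.prems(1) by (metis coprime_commute coprime_iff_gcd_eq_1 gcd_diff1)
      then obtain w where "w \<in> lists {0, 1}" "lake_vector w = (p, q - p)"
        using less.hyps[of p "q - p"] less.prems 3 by auto
      then show ?thesis by (intro bexI[of _ "1 # w"]) auto
    qed
  qed
  with that show thesis by blast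
qed

fun config_run :: "config \<Rightarrow> nat list \<Rightarrow> config" where
  "config_run s [] = s"
| "config_run s (x # w) = config_run (if x = 0 then config_left s else config_right s) w"

text \<open>The substitutions of the turns compose to one that sends \<open>(1, 1)\<close>, the
  position of the region ahead, to \<open>lake_vector w\<close>.\<close>

lemma config_run_ahead:
  assumes "config_run (a, b, c) w = (a', b', c')" "lake_vector w = (p, q)"
  shows "a' + b' + c' = a * p\<^sup>2 + b * p * q + c * q\<^sup>2"
  using assms
proof (induction w arbitrary: a b c p q)
  case (Cons x w)
  obtain r s where rs: "lake_vector w = (r, s)" by fastforce
  show ?case
  proof (cases "x = 0")
    case True
    then have "p = r + s" "q = s" using Cons.prems(2) rs by simp_all
    with Cons.IH[of a "2 * a + b" "a + b + c" r s] Cons.prems(1) True rs show ?thesis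
      by (simp add: algebra_simps power2_eq_square)
  next
    case False
    then have "p = r" "q = r + s" using Cons.prems(2) rs by simp_all
    with Cons.IH[of "a + b + c" "b + 2 * c" c r s] Cons.prems(1) False rs show ?thesis
      by (simp add: algebra_simps power2_eq_square)
  qed
qed simp

fun config_scale :: "int \<Rightarrow> config \<Rightarrow> config" where
  "config_scale k (a, b, c) = (k * a, k * b, k * c)"

lemma config_scale_left: "config_left (config_scale k s) = config_scale k (config_left s)"
  and config_scale_right: "config_right (config_scale k s) = config_scale k (config_right s)"
  by (cases s; simp add: algebra_simps)+

lemma config_run_scale: "config_run (config_scale k s) w = config_scale k (config_run s w)"
  by (induction w arbitrary: s) (simp_all add: config_scale_left config_scale_right)

text \<open>The configuration with a lake behind and the lake at \<open>(p, q) = lake_vector w\<close> ahead.\<close>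

definition source_config :: "nat list \<Rightarrow> config" where
  "source_config w = (let (p, q) = lake_vector w in (q, q - p, - p))"

lemma source_config_inj:
  "w \<in> lists {0, 1} \<Longrightarrow> w' \<in> lists {0, 1} \<Longrightarrow> source_config w = source_config w' \<Longrightarrow> w = w'"
  by (rule lake_vector_inj) (auto simp: source_config_def Let_def split: prod.splits)

text \<open>The arithmetic shadow of a river followed downstream: the banks keep their signs, and
  the clause for \<open>[]\<close> puts a lake ahead of the last dart.\<close>

fun river_config :: "config \<Rightarrow> nat list \<Rightarrow> bool" where
  "river_config (a, b, c) [] \<longleftrightarrow> a > 0 \<and> c < 0 \<and> a + b + c = 0"
| "river_config (a, b, c) (x # w) \<longleftrightarrow> a > 0 \<and> c < 0 \<and>
    river_config (if x = 0 then config_left (a, b, c) else config_right (a, b, c)) w"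

text \<open>Along the river the form stays a product \<open>(q x - p y) (r x + s y)\<close> with positive
  coefficients.\<close>

lemma river_config_factored:
  assumes "w \<in> lists {0, 1}" "lake_vector w = (p, q)" "r > 0" "s > 0"
  shows "river_config (q * r, q * s - p * r, - (p * s)) w \<and>
    (\<exists>r' s'. r' > 0 \<and> s' > 0 \<and>
      config_run (q * r, q * s - p * r, - (p * s)) w = (r', s' - r', - s'))"
  using assms
proof (induction w arbitrary: p q r s rule: list.induct)
  case Nil
  then show ?case by auto
next
  case (Cons x w)
  obtain p' q' where pq': "lake_vector w = (p', q')" by fastforce
  note pos = lake_vector_pos[OF pq']
  show ?case
  proof (cases "x = 0")
    case True
    then have "p = p' + q'" "q = q'" using Cons.prems pq' by simp_all
    \<comment> \<open>Replacing \<open>x\<close> by \<open>x + y\<close> turns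
      \<open>q x - p y\<close> into \<open>q' x - p' y\<close> and \<open>r x + s y\<close> into
      \<open>r x + (r + s) y\<close>: the first factor shrinks by a Euclidean step while the second
      grows.\<close>
    moreover from this have
      "config_left (q * r, q * s - p * r, - (p * s)) =
        (q' * r, q' * (r + s) - p' * r, - (p' * (r + s)))"
      by (simp add: algebra_simps)
    ultimately show ?thesis
      using Cons.IH[OF _ pq', of r "r + s"] Cons.prems True pos by simp
  next
    case False
    then have "p = p'" "q = p' + q'" using Cons.prems pq' by simp_all
    moreover from this have
      "config_right (q * r, q * s - p * r, - (p * s)) =
        (q' * (r + s), q' * s - p' * (r + s), - (p' * s))"
      by (simp add: algebra_simps)
    ultimately show ?thesis
      using Cons.IH[OF _ pq', of "r + s" s] Cons.prems False pos by simp
  qed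
qed

lemma river_config_source: "w \<in> lists {0, 1} \<Longrightarrow> river_config (source_config w) w"
  using river_config_factored[of w _ _ 1 1]
  by (auto simp: source_config_def Let_def split: prod.splits)

lemma config_run_source:
  assumes "w \<in> lists {0, 1}"
  obtains r s where "r > 0" "s > 0" "config_run (source_config w) w = (r, s - r, - s)"
proof -
  obtain p q where "lake_vector w = (p, q)" by fastforce
  with river_config_factored[OF assms this, of 1 1] that show thesis
    by (auto simp: source_config_def)
qed

text \<open>With a lake behind, the form is \<open>(x + y) (a x + c y)\<close>. A zero at positive
  \<open>(p, q)\<close> must come from the second factor, and coprimality makes
  \<open>(a, - c)\<close> a multiple of \<open>(q, p)\<close>.\<close>

lemma two_lakes_config:
  assumes "a > 0" "c < 0" "lake_vector w = (p, q)" "a * p\<^sup>2 + (a + c) * p * q + c * q\<^sup>2 = 0"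
  obtains k where "k > 0" "(a, a + c, c) = config_scale k (source_config w)"
proof -
  have pos: "p > 0" "q > 0" and cop: "coprime p q"
    using lake_vector_pos coprime_lake_vector assms(3) by auto
  have "(p + q) * (a * p + c * q) = 0"
    using assms(4) by (simp add: algebra_simps power2_eq_square)
  then have ap: "a * p = - c * q" using pos by auto
  then have "q dvd a * p" by simp
  then have "q dvd a" using cop by (simp add: coprime_commute coprime_dvd_mult_left_iff)
  then obtain k where k: "a = q * k" by blast
  then have "q * (k * p) = q * (- c)" using ap by (simp add: algebra_simps)
  then have "k * p = - c" using pos(2) mult_left_cancel[of q "k * p" "- c"] by blast
  then have "c = - (k * p)" by simp
  moreover have "k > 0" using k assms(1) pos by (simp add: zero_less_mult_iff)
  ultimately show thesis
    using that k assms(3) by (simp add: source_config_def algebra_simps)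
qed

section \<open>Forward darts\<close>

context plane_tree
begin

text \<open>The half-tree beyond \<open>d\<close>. The rules add a last turn;
  \<open>forward_unfold\<close> splits off the first one.\<close>

inductive_set forward :: "'v \<times> 'v \<Rightarrow> ('v \<times> 'v) set" for d where
  base: "d \<in> forward d"
| left: "e \<in> forward d \<Longrightarrow> left_next T e \<in> forward d"
| right: "e \<in> forward d \<Longrightarrow> right_next T e \<in> forward d"

lemma forward_dart: "e \<in> forward d \<Longrightarrow> d \<in> darts T \<Longrightarrow> e \<in> darts T"
  by (induction rule: forward.induct) auto

lemma forward_unfold:
  "e \<in> forward d \<Longrightarrow> e = d \<or> e \<in> forward (left_next T d) \<or> e \<in> forward (right_next T d)"
  by (induction rule: forward.induct) (auto intro: forward.intros)

lemma forward_cases: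
  assumes "e \<in> forward d"
  obtains "e = d" | f where "f \<in> forward d" "e = left_next T f"
  | f where "f \<in> forward d" "e = right_next T f"
  using assms by cases blast+

lemma forward_trans: "e \<in> forward e' \<Longrightarrow> e' \<in> forward d \<Longrightarrow> e \<in> forward d"
  by (induction rule: forward.induct) (auto intro: forward.intros)

lemma forward_invariant:
  assumes "e \<in> forward d" "d \<in> darts T" "P (h d)"
    and "\<And>d. d \<in> darts T \<Longrightarrow> h (left_next T d) = config_left (h d)"
    and "\<And>d. d \<in> darts T \<Longrightarrow> h (right_next T d) = config_right (h d)"
    and "\<And>s. P s \<Longrightarrow> P (config_left s) \<and> P (config_right s)"
  shows "P (h e)"
  using assms(1) by induction (use assms forward_dart in auto)

text \<open>Cutting the edge of \<open>d0\<close> leaves two half-trees; the four cases are the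
  choices of a half and of a direction.\<close>

lemma dart_forward_cases:
  assumes "d \<in> darts T" "d0 \<in> darts T"
  obtains "d \<in> forward d0" | "prod.swap d \<in> forward d0"
  | "d \<in> forward (prod.swap d0)" | "prod.swap d \<in> forward (prod.swap d0)"
proof -
  define F where "F = forward d0 \<union> forward (prod.swap d0)"
  have F_dart: "e \<in> darts T" if "e \<in> F" for e
    using that assms(2) forward_dart unfolding F_def by (metis UnE swap_dart)
  have F_next: "left_next T e \<in> F" "right_next T e \<in> F" if "e \<in> F" for e
    using that forward.left forward.right unfolding F_def by blast+
  have F_base: "d0 \<in> F" "prod.swap d0 \<in> F"
    by (simp_all add: F_def forward.base)
  have "d \<in> F \<or> prod.swap d \<in> F"
    using assms
  proof (induction rule: dart_induct)
    case base
    then show ?case using F_base by simp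
  next
    case (swap d)
    then show ?case by auto
  next
    case (cw d)
    from cw(2) show ?case
    proof
      assume "prod.swap d \<in> F"
      from F_next(1)[OF this] show ?thesis by (simp add: left_next_def)
    next
      assume "d \<in> F"
      \<comment> \<open>Rotating the left turn after \<open>e\<close> gives the right turn, and
        rotating that gives the reverse of \<open>e\<close>.\<close>
      then consider "d = d0" | "d = prod.swap d0"
        | e where "e \<in> F" "d = left_next T e" | e where "e \<in> F" "d = right_next T e"
        unfolding F_def by (metis UnE UnI1 UnI2 forward_cases)
      then show ?thesis
      proof cases
        case 1
        then show ?thesis using F_next(1)[OF F_base(2)] by (simp add: left_next_def)
      next
        case 2
        then show ?thesis using F_next(1)[OF F_base(1)] by (simp add: left_next_def)
      next
        case (3 e)
        then show ?thesis using F_next(2)[of e] by (simp add: left_next_def right_next_def)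
      next
        case (4 e)
        then have "cw T d = prod.swap e" using F_dart by (simp add: right_next_def)
        then show ?thesis using 4 by simp
      qed
    qed
  qed
  with that show thesis by (auto simp: F_def)
qed

fun follow :: "'v \<times> 'v \<Rightarrow> nat list \<Rightarrow> ('v \<times> 'v) list" where
  "follow d [] = [d]"
| "follow d (x # w) = d # follow (if x = 0 then left_next T d else right_next T d) w"

lemma hd_follow [simp]: "hd (follow d w) = d"
  by (cases w) simp_all

lemma length_follow [simp]: "length (follow d w) = Suc (length w)"
  by (induction w arbitrary: d) simp_all

lemma follow_not_Nil [simp]: "follow d w \<noteq> []"
  by (cases w) simp_all

lemma walk_follow: "d \<in> darts T \<Longrightarrow> walk (follow d w)"
proof (induction w arbitrary: d)
  case (Cons x w)
  let ?e = "if x = 0 then left_next T d else right_next T d"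
  have "?e \<in> darts T" "turns d ?e"
    using Cons.prems turns_iff[OF Cons.prems] by auto
  with Cons show ?case by (simp add: walk_Cons)
qed (simp add: walk_def)

lemma follow_darts: "d \<in> darts T \<Longrightarrow> set (follow d w) \<subseteq> darts T"
  using walk_follow[of d w] by (simp add: walk_def)

lemma follow_forward: "set (follow d w) \<subseteq> forward d"
proof (induction w arbitrary: d)
  case (Cons x w)
  have "e \<in> forward d" if "e \<in> forward (left_next T d) \<or> e \<in> forward (right_next T d)" for e
    using that forward_trans forward.intros by blast
  with Cons[of "left_next T d"] Cons[of "right_next T d"] show ?case
    by (auto intro: forward.base)
qed (simp add: forward.base)

lemma follow_regions:
  assumes "d \<in> darts T" "i < length w"
  shows "w ! i = 0 \<Longrightarrow> left_region T (follow d w ! Suc i) = left_region T (follow d w ! i)"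
    and "w ! i \<noteq> 0 \<Longrightarrow> right_region T (follow d w ! Suc i) = right_region T (follow d w ! i)"
proof -
  have "(w ! i = 0 \<longrightarrow> left_region T (follow d w ! Suc i) = left_region T (follow d w ! i)) \<and>
    (w ! i \<noteq> 0 \<longrightarrow> right_region T (follow d w ! Suc i) = right_region T (follow d w ! i))"
    using assms
  proof (induction w arbitrary: d i)
    case (Cons x w)
    show ?case
    proof (cases i)
      case 0
      have "follow e w ! 0 = e" for e by (metis hd_conv_nth hd_follow follow_not_Nil)
      with 0 Cons.prems show ?thesis by (simp del: left_region_right_next)
    next
      case (Suc j)
      then show ?thesis
        using Cons.IH[of "if x = 0 then left_next T d else right_next T d" j] Cons.prems
        by (simp del: left_region_right_next right_region_left_next)
    qed
  qed simp
  then show "w ! i = 0 \<Longrightarrow> left_region T (follow d w ! Suc i) = left_region T (follow d w ! i)"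
    and "w ! i \<noteq> 0 \<Longrightarrow> right_region T (follow d w ! Suc i) = right_region T (follow d w ! i)"
    by blast+
qed

text \<open>The region that is kept decides the turn: after a left turn the right region is the one
  that was ahead, which differs from the old right region, and symmetrically.\<close>

lemma eq_followI:
  assumes "walk ds" "length ds = Suc (length w)"
    and "\<And>i. i < length w \<Longrightarrow>
      w ! i = 0 \<and> left_region T (ds ! Suc i) = left_region T (ds ! i) \<or>
      w ! i = 1 \<and> right_region T (ds ! Suc i) = right_region T (ds ! i)"
  shows "w \<in> lists {0, 1} \<and> ds = follow (hd ds) w"
  using assms
proof (induction w arbitrary: ds)
  case Nil
  then show ?case by (cases ds) auto
next
  case (Cons x w)
  then obtain d e es where ds: "ds = d # e # es"
    by (cases ds rule: remdups_adj.cases) auto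
  have d: "d \<in> darts T" "e \<in> darts T" "turns d e"
    using Cons.prems(1) by (auto simp: ds walk_Cons walk_def)
  have x: "x = 0 \<and> left_region T e = left_region T d \<or> x = 1 \<and> right_region T e = right_region T d"
    using Cons.prems(3)[of 0] by (simp add: ds)
  have "e = (if x = 0 then left_next T d else right_next T d)"
  proof (cases "e = left_next T d")
    case True
    then show ?thesis
      using x right_ne_ahead_region[OF d(1)] right_region_left_next[OF d(1)] by auto
  next
    case False
    then have "e = right_next T d" using turns_iff[OF d(1,2)] d(3) by blast
    then show ?thesis
      using x left_ne_ahead_region[OF d(1)] left_region_right_next[of d] by auto
  qed
  moreover have "w \<in> lists {0, 1} \<and> e # es = follow (hd (e # es)) w"
  proof (rule Cons.IH)
    show "walk (e # es)" using Cons.prems(1) by (simp add: ds walk_Cons)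
    show "length (e # es) = Suc (length w)" using Cons.prems(2) by (simp add: ds)
    fix i assume "i < length w"
    then show "w ! i = 0 \<and> left_region T ((e # es) ! Suc i) = left_region T ((e # es) ! i) \<or>
      w ! i = 1 \<and> right_region T ((e # es) ! Suc i) = right_region T ((e # es) ! i)"
      using Cons.prems(3)[of "Suc i"] by (simp add: ds)
  qed
  ultimately show ?case using x by (auto simp: ds)
qed

text \<open>A U-turn would visit the tail of \<open>d\<close> twice.\<close>

lemma apath_walk: "apath u ds v \<Longrightarrow> ds \<noteq> [] \<Longrightarrow> walk ds"
proof (induction ds arbitrary: u)
  case (Cons d ds)
  show ?case
  proof (cases ds)
    case Nil
    then show ?thesis using Cons.prems by (simp add: walk_def apath_Cons_iff)
  next
    case ds: (Cons e es)
    have d: "d \<in> darts T" and ap: "apath (snd d) (e # es) v"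
      and nin: "fst d \<notin> set (pawalk_verts (snd d) (e # es))"
      using Cons.prems(1) unfolding ds apath_Cons_iff[of u d] by auto
    have "apath (snd e) es v" using ap apath_Cons_iff[of "snd d" e] by simp
    then have "snd e \<in> set (pawalk_verts (snd d) (e # es))"
      using hd_in_awalk_verts(2) by auto
    with nin have "e \<noteq> prod.swap d" by auto
    moreover have "fst e = snd d" using ap by (simp add: apath_Cons_iff)
    ultimately show ?thesis
      using Cons.IH[of "snd d"] ap d by (simp add: ds walk_Cons turns_def)
  qed
qed simp

end

section \<open>The river\<close>

text \<open>The labelling by \<open>(x + y)^2\<close> vanishes behind \<open>d\<close> and is
  positive in the half-tree ahead. This separates the two lakes.\<close>

lemma (in plane_tree) behind_ne_ahead_region:
  assumes "d \<in> darts T" "e \<in> forward d"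
  shows "behind_region T d \<noteq> ahead_region T e"
proof
  obtain h where h: "h d = (1, 2, 1)"
    "\<And>d. d \<in> darts T \<Longrightarrow> h (prod.swap d) = config_swap (h d)"
    "\<And>d. d \<in> darts T \<Longrightarrow> h (left_next T d) = config_left (h d)"
    "\<And>d. d \<in> darts T \<Longrightarrow> h (right_next T d) = config_right (h d)"
    by (rule config_labelling[OF assms(1), of "(1, 2, 1)"]) blast
  define P :: "config \<Rightarrow> bool" where "P = (\<lambda>(a, b, c). a > 0 \<and> b > 0 \<and> c > 0)"
  have "P (h e)"
    by (rule forward_invariant[where h = h and P = P, OF assms(2,1) _ h(3,4)]) (auto simp: P_def h(1))
  then have ahead: "fst (h (right_next T e)) > 0"
    using h(4)[OF forward_dart[OF assms(2,1)]] by (cases "h e") (simp add: P_def)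
  let ?d = "right_next T (prod.swap d)"
  have "h ?d = (0, 0, 1)"
    using h(1) h(2)[OF assms(1)] h(4)[of "prod.swap d"] assms(1) by simp
  assume "behind_region T d = ahead_region T e"
  then have "left_region T ?d = left_region T (right_next T e)" by simp
  then have "fst (h ?d) = fst (h (right_next T e))"
    by (rule config_labelling_region[where h = h, OF _ _ h(3), rotated]) (use assms(1) in simp_all)
  with ahead \<open>h ?d = (0, 0, 1)\<close> show False by simp
qed

context topograph_tree
begin

lemma config_last_follow:
  "d \<in> darts T \<Longrightarrow> config T (last (follow d w)) = config_run (config T d) w"
  by (induction w arbitrary: d) simp_all

lemma forward_config:
  assumes "e \<in> forward d" "d \<in> darts T" "P (config T d)"
    and "\<And>s. P s \<Longrightarrow> P (config_left s) \<and> P (config_right s)"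
  shows "P (config T e)"
  by (rule forward_invariant[where h = "config T" and P = P]) (use assms in simp_all)

definition crosses :: "'v \<times> 'v \<Rightarrow> bool" where
  "crosses d \<longleftrightarrow> label T (left_region T d) * label T (right_region T d) < 0"

text \<open>Both turns only add entries to one another, so nonnegativity persists and no sign change
  can follow.\<close>

lemma no_crossing_nonneg:
  assumes "e \<in> forward d" "d \<in> darts T" "config T d = (a, b, c)" "a \<ge> 0" "b \<ge> 0" "c \<ge> 0"
  shows "\<not> crosses e"
proof -
  have "(\<lambda>(a, b, c). a \<ge> 0 \<and> b \<ge> 0 \<and> c \<ge> 0) (config T e)"
    by (rule forward_config[OF assms(1,2)]) (use assms in auto)
  then show ?thesis by (auto simp: crosses_def config_def mult_less_0_iff)
qed

lemma no_crossing_nonpos: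
  assumes "e \<in> forward d" "d \<in> darts T" "config T d = (a, b, c)" "a \<le> 0" "b \<le> 0" "c \<le> 0"
  shows "\<not> crosses e"
proof -
  have "(\<lambda>(a, b, c). a \<le> 0 \<and> b \<le> 0 \<and> c \<le> 0) (config T e)"
    by (rule forward_config[OF assms(1,2)]) (use assms in auto)
  then show ?thesis by (auto simp: crosses_def config_def mult_less_0_iff)
qed

text \<open>Behind every later dart lies a bank of its predecessor, whose label is nonzero. Hence
  only the first river dart has a lake behind it, which later gives uniqueness.\<close>

lemma river_follow:
  assumes "d \<in> darts T" "config T d = s" "river_config s w" "e \<in> set (follow d w)"
  shows "label T (left_region T e) > 0 \<and> label T (right_region T e) < 0 \<and>
    (e = d \<or> label T (behind_region T e) \<noteq> 0)"
  using assms
proof (induction w arbitrary: d s)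
  case Nil
  then show ?case by (cases s) (auto simp: config_def)
next
  case (Cons x w)
  obtain a b c where s: "s = (a, b, c)" by (cases s)
  have lab: "label T (left_region T d) = a" "label T (right_region T d) = c"
    using Cons.prems(2) by (simp_all add: s config_def)
  show ?case
  proof (cases "e = d")
    case True
    then show ?thesis using Cons.prems(3) lab by (simp add: s)
  next
    case False
    define f where "f = (if x = 0 then left_next T d else right_next T d)"
    have "label T (behind_region T f) \<noteq> 0"
      using Cons.prems(1,3) lab by (simp add: s f_def)
    moreover have "e \<in> set (follow f w)"
      using Cons.prems(4) False by (simp add: f_def)
    moreover have "river_config (config T f) w"
      using Cons.prems(1,2,3) by (simp add: s f_def split: if_splits)
    moreover have "f \<in> darts T" using Cons.prems(1) by (simp add: f_def)
    ultimately show ?thesis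
      using Cons.IH[of f "config T f"] by blast
  qed
qed

text \<open>At each fork the branch off the river has labels of the same sign on both sides, and
  this forces the sign of its middle entry too; so its half-tree contains no crossing.\<close>

lemma crossing_in_follow:
  assumes "d \<in> darts T" "config T d = s" "river_config s w" "crosses e" "e \<in> forward d"
  shows "e \<in> set (follow d w)"
  using assms
proof (induction w arbitrary: d s)
  case Nil
  obtain a b c where s: "s = (a, b, c)" by (cases s)
  \<comment> \<open>At the lake both branches are clear: \<open>a + b + c = 0\<close> gives
    \<open>2 * a + b = a - c > 0\<close> and \<open>b + 2 * c = c - a < 0\<close>.\<close>
  have "\<not> crosses e" if "e \<in> forward (left_next T d)"
    by (rule no_crossing_nonneg[OF that, of a "2 * a + b" 0]) (use Nil in \<open>auto simp: s\<close>)
  moreover have "\<not> crosses e" if "e \<in> forward (right_next T d)"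
    by (rule no_crossing_nonpos[OF that, of 0 "b + 2 * c" c]) (use Nil in \<open>auto simp: s\<close>)
  ultimately show ?case using forward_unfold[OF Nil.prems(5)] Nil.prems(4) by auto
next
  case (Cons x w)
  obtain a b c where s: "s = (a, b, c)" by (cases s)
  have ac: "a > 0" "c < 0" using Cons.prems(3) by (simp_all add: s)
  show ?case
  proof (cases "x = 0")
    case True
    have "river_config (a, 2 * a + b, a + b + c) w"
      using Cons.prems(3) True by (simp add: s)
    then have "a + b + c < 0" by (cases w) simp_all
    then have "\<not> crosses e" if "e \<in> forward (right_next T d)"
      by (intro no_crossing_nonpos[OF that, of "a + b + c" "b + 2 * c" c])
        (use Cons.prems(1,2) ac in \<open>auto simp: s\<close>)
    moreover have "e \<in> set (follow (left_next T d) w)" if "e \<in> forward (left_next T d)"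
      by (rule Cons.IH[OF _ _ _ Cons.prems(4) that]) (use Cons.prems(1-3) True in \<open>auto simp: s\<close>)
    ultimately show ?thesis
      using forward_unfold[OF Cons.prems(5)] Cons.prems(4) True by auto
  next
    case False
    have "river_config (a + b + c, b + 2 * c, c) w"
      using Cons.prems(3) False by (simp add: s)
    then have "a + b + c > 0" by (cases w) simp_all
    then have "\<not> crosses e" if "e \<in> forward (left_next T d)"
      by (intro no_crossing_nonneg[OF that, of a "2 * a + b" "a + b + c"])
        (use Cons.prems(1,2) ac in \<open>auto simp: s\<close>)
    moreover have "e \<in> set (follow (right_next T d) w)" if "e \<in> forward (right_next T d)"
      by (rule Cons.IH[OF _ _ _ Cons.prems(4) that]) (use Cons.prems(1-3) False in \<open>auto simp: s\<close>)
    ultimately show ?thesis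
      using forward_unfold[OF Cons.prems(5)] Cons.prems(4) False by auto
  qed
qed

lemma river_path_follow:
  assumes d: "d \<in> darts T" and w: "w \<in> lists {0, 1}" and conf: "config T d = source_config w"
  shows "river_path T (follow d w)"
proof -
  obtain p q where pq: "lake_vector w = (p, q)" by fastforce
  have pos: "p > 0" "q > 0" using lake_vector_pos[OF pq] by auto
  have config_d: "config T d = (q, q - p, - p)" using conf pq by (simp add: source_config_def)
  note river = river_follow[OF d conf river_config_source[OF w]]
  \<comment> \<open>Upstream both branches run along the lake behind \<open>d\<close>: one entry is
    0 and the other two have the same sign.\<close>
  have behind: "f = prod.swap d" if "crosses f" "f \<in> forward (prod.swap d)" for f
  proof -
    have sd: "prod.swap d \<in> darts T" using d by simp
    have cs: "config T (prod.swap d) = (- p, p - q, q)"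
      using config_d d by simp
    have "\<not> crosses f" if "f \<in> forward (left_next T (prod.swap d))"
      by (rule no_crossing_nonpos[OF that, of "- p" "- p - q" 0])
        (use sd cs pos in \<open>simp_all del: config_swap_dart\<close>)
    moreover have "\<not> crosses f" if "f \<in> forward (right_next T (prod.swap d))"
      by (rule no_crossing_nonneg[OF that, of 0 "p + q" q])
        (use sd cs pos in \<open>simp_all del: config_swap_dart\<close>)
    ultimately show ?thesis using forward_unfold[OF that(2)] that(1) by blast
  qed
  have "river_darts T = set (follow d w)"
  proof (intro equalityI subsetI)
    fix e assume "e \<in> river_darts T"
    then have e: "e \<in> darts T" "label T (left_region T e) > 0" "label T (right_region T e) < 0"
      by (auto simp: river_darts_def)
    then have cross: "crosses e" "crosses (prod.swap e)"
      by (simp_all add: crosses_def mult_less_0_iff)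
    note inside = crossing_in_follow[OF d conf river_config_source[OF w]]
    show "e \<in> set (follow d w)"
      using e(1) d
    proof (cases rule: dart_forward_cases)
      case 1
      then show ?thesis using inside cross by blast
    next
      case 2
      then have "prod.swap e \<in> set (follow d w)" using inside cross by blast
      from river[OF this] e show ?thesis by simp
    next
      case 3
      then have "e = prod.swap d" using behind cross by blast
      then show ?thesis using e(2) config_d pos by (simp add: config_def)
    next
      case 4
      then have "prod.swap e = prod.swap d" using behind cross by blast
      then have "e = d" by (metis swap_swap)
      then show ?thesis using hd_in_set[of "follow d w"] by simp
    qed
  next
    fix e assume "e \<in> set (follow d w)"
    then show "e \<in> river_darts T"
      using river[of e] follow_darts[OF d, of w] by (auto simp: river_darts_def)
  qed
  moreover have "label T (behind_region T d) = 0"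
    using behind_label[OF config_d] by simp
  moreover have last_dart: "last (follow d w) \<in> set (follow d w)" by simp
  then have "label T (ahead_region T (last (follow d w))) = 0"
  proof -
    obtain r s where "config_run (source_config w) w = (r, s - r, - s)"
      using config_run_source[OF w] by metis
    then have "config T (last (follow d w)) = (r, s - r, - s)"
      using config_last_follow[OF d] conf by simp
    then show ?thesis
      using ahead_label last_dart follow_darts[OF d] by fastforce
  qed
  moreover have "behind_region T d \<noteq> ahead_region T (last (follow d w))"
    using behind_ne_ahead_region[OF d] follow_forward last_dart by blast
  ultimately show ?thesis
    using walk_apath[OF walk_follow[OF d]] unfolding river_path_def by auto
qed

lemma config_dvd:
  assumes "d0 \<in> darts T" "config T d0 = config_scale k s" "d \<in> darts T"
  shows "\<exists>s. config T d = config_scale k s"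
  using assms(3,1)
proof (induction rule: dart_induct)
  case base
  then show ?case using assms(2) by blast
next
  case (swap d)
  have "config_swap (config_scale k s) = config_scale k (config_swap s)" for s
    by (cases s) simp
  with swap show ?case by (metis config_swap_dart)
next
  case (cw d)
  have "config_cw (config_scale k s) = config_scale k (config_cw s)" for s
    by (cases s) (simp add: config_cw_def algebra_simps)
  with cw show ?case by (metis config_cw_dart)
qed

lemma config_scale_dvd_Gcd:
  assumes "d0 \<in> darts T" "config T d0 = config_scale k s"
  shows "k dvd Gcd (label T ` regions T)"
proof (rule Gcd_greatest)
  fix x assume "x \<in> label T ` regions T"
  then obtain d where d: "d \<in> darts T" "x = label T (left_region T d)"
    by (auto simp: regions_def)
  obtain a b c where "config T d = config_scale k (a, b, c)"
    using config_dvd[OF assms d(1)] by (metis prod_cases3)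
  then show "k dvd x" using d(2) by (simp add: config_def)
qed

end

locale primitive_tree = topograph_tree +
  assumes gcd1: "Gcd (label T ` regions T) = 1"
begin

text \<open>The form in which primitivity is used: a common factor of a single configuration would
  divide every label.\<close>

lemma config_scale_imp_unit:
  "d \<in> darts T \<Longrightarrow> config T d = config_scale k s \<Longrightarrow> \<bar>k\<bar> = 1"
  using config_scale_dvd_Gcd[of d k s] gcd1 by (simp add: zdvd1_eq)

text \<open>Trades paths for the occurrence of a single configuration, a property that isomorphisms
  visibly preserve.\<close>

theorem is_river_sequence_iff:
  "is_river_sequence T w \<longleftrightarrow> w \<in> lists {0, 1} \<and> (\<exists>d\<in>darts T. config T d = source_config w)"
proof
  assume "is_river_sequence T w"
  then obtain ds where ds: "river_path T ds" "length ds = Suc (length w)"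
    "\<And>i. i < length w \<Longrightarrow>
      w ! i = 0 \<and> left_region T (ds ! Suc i) = left_region T (ds ! i) \<or>
      w ! i = 1 \<and> right_region T (ds ! Suc i) = right_region T (ds ! i)"
    unfolding is_river_sequence_def by blast
  then have "walk ds" using apath_walk unfolding river_path_def by blast
  then have w: "w \<in> lists {0, 1}" and follow: "ds = follow (hd ds) w"
    using eq_followI ds(2,3) by blast+
  define d where "d = hd ds"
  have "d \<in> river_darts T"
    using ds(1) hd_in_set[of ds] unfolding river_path_def d_def by blast
  then have d: "d \<in> darts T" and sign: "label T (left_region T d) > 0" "label T (right_region T d) < 0"
    by (auto simp: river_darts_def)
  obtain a b c where abc: "config T d = (a, b, c)" by (cases "config T d")
  have "a - b + c = 0"
    using ds(1) behind_label[OF abc] by (simp add: river_path_def d_def)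
  then have b: "b = a + c" by simp
  have ac: "a > 0" "c < 0" using sign abc by (auto simp: config_def)
  obtain p q where pq: "lake_vector w = (p, q)" by fastforce
  obtain a' b' c' where last: "config_run (a, b, c) w = (a', b', c')"
    by (cases "config_run (a, b, c) w")
  then have "config T (last ds) = (a', b', c')"
    using config_last_follow[OF d, of w] follow abc by (simp add: d_def)
  moreover have "last ds \<in> darts T"
    using \<open>walk ds\<close> last_in_set[of ds] unfolding walk_def by blast
  ultimately have "a' + b' + c' = 0"
    using ahead_label ds(1) by (simp add: river_path_def)
  then have "a * p\<^sup>2 + (a + c) * p * q + c * q\<^sup>2 = 0"
    using config_run_ahead[OF last pq] b by simp
  then obtain k where k: "k > 0" "(a, a + c, c) = config_scale k (source_config w)"
    using two_lakes_config[OF ac pq] by blast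
  then have "k = 1"
    using config_scale_imp_unit[OF d, of k] abc b by simp
  moreover have "config_scale 1 s = s" for s by (cases s) simp
  ultimately have "config T d = source_config w" using abc b k(2) by simp
  with w d show "w \<in> lists {0, 1} \<and> (\<exists>d\<in>darts T. config T d = source_config w)" by blast
next
  assume "w \<in> lists {0, 1} \<and> (\<exists>d\<in>darts T. config T d = source_config w)"
  then obtain d where w: "w \<in> lists {0, 1}" and d: "d \<in> darts T" "config T d = source_config w"
    by blast
  have "w ! i = 0 \<and> left_region T (follow d w ! Suc i) = left_region T (follow d w ! i) \<or>
    w ! i = 1 \<and> right_region T (follow d w ! Suc i) = right_region T (follow d w ! i)"
    if i: "i < length w" for i
  proof -
    have "w ! i \<in> {0, 1}" using w nth_mem[OF i] unfolding lists_eq_set by blast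
    then show ?thesis using follow_regions[OF d(1) i] by auto
  qed
  with river_path_follow[OF d(1) w d(2)] show "is_river_sequence T w"
    unfolding is_river_sequence_def by (intro exI[of _ "follow d w"]) simp
qed

text \<open>Both paths run through the same set of darts, in which only the first has a lake behind
  it. So they share that dart, and its configuration determines the word.\<close>

theorem river_sequence_unique:
  assumes "is_river_sequence T w" "is_river_sequence T w'"
  shows "w = w'"
proof -
  obtain d where w: "w \<in> lists {0, 1}" and d: "d \<in> darts T" "config T d = source_config w"
    using assms(1) unfolding is_river_sequence_iff by blast
  obtain d' where w': "w' \<in> lists {0, 1}" and d': "d' \<in> darts T" "config T d' = source_config w'"
    using assms(2) unfolding is_river_sequence_iff by blast
  have path: "river_path T (follow d w)" "river_path T (follow d' w')"
    using river_path_follow d d' w w' by blast+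
  then have "set (follow d w) = set (follow d' w')"
    by (simp add: river_path_def)
  then have "d \<in> set (follow d' w')"
    using hd_in_set[of "follow d w"] by simp
  moreover have "label T (behind_region T d) = 0"
    using path(1) by (simp add: river_path_def)
  ultimately have "d = d'"
    using river_follow[OF d' river_config_source[OF w']] by blast
  then show ?thesis using source_config_inj[OF w w'] d d' by simp
qed

end

section \<open>Existence of the river\<close>

context plane_tree
begin

lemma darts_nonempty: obtains d where "d \<in> darts T"
proof -
  have "connected (with_proj (skel T))"
    using plane by (simp add: plane_cubic_tree_def cubic_tree_def)
  then have "pverts (skel T) \<noteq> {}" by (simp add: connected_conv)
  then show thesis using that pverts_eq by auto
qed

end

context topograph_tree
begin

lemma config_discriminant:
  assumes "has_discriminant T D" "d \<in> darts T" "config T d = (a, b, c)"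
  shows "b\<^sup>2 - 4 * a * c = D"
  using assms by (auto simp: has_discriminant_def config_def)

lemma has_discriminantI:
  assumes "d0 \<in> darts T" "config T d0 = (a, b, c)"
  shows "has_discriminant T (b\<^sup>2 - 4 * a * c)"
proof -
  define disc :: "config \<Rightarrow> int" where "disc = (\<lambda>(a, b, c). b\<^sup>2 - 4 * a * c)"
  have disc_swap: "disc (config_swap s) = disc s" for s
    by (cases s) (simp add: disc_def)
  have disc_cw: "disc (config_cw s) = disc s" for s
    by (cases s) (simp add: disc_def config_cw_def power2_eq_square algebra_simps)
  have "disc (config T d) = disc (config T d0)" if "d \<in> darts T" for d
    using that assms(1) by (induction rule: dart_induct) (simp_all add: disc_swap disc_cw)
  then show ?thesis
    using assms(2) by (simp add: has_discriminant_def disc_def config_def)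
qed

lemma isotropic_region:
  assumes "d \<in> darts T" "config T d = (a, b, c)" "coprime p q" "p > 0" "q > 0"
    and "a * p\<^sup>2 + b * p * q + c * q\<^sup>2 = 0"
  obtains e where "e \<in> darts T" "label T (left_region T e) = 0"
proof -
  obtain w where w: "w \<in> lists {0, 1}" "lake_vector w = (p, q)"
    using lake_vector_surj assms(3-5) by blast
  define f where "f = last (follow d w)"
  have f: "f \<in> darts T"
    using follow_darts[OF assms(1), of w] last_in_set[of "follow d w"] by (auto simp: f_def)
  obtain a' b' c' where run: "config_run (a, b, c) w = (a', b', c')"
    by (cases "config_run (a, b, c) w")
  then have "config T f = (a', b', c')"
    using config_last_follow[OF assms(1), of w] assms(2) by (simp add: f_def)
  from ahead_label[OF f this] config_run_ahead[OF run w(2)] assms(6)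
  have "label T (left_region T (right_next T f)) = 0" by simp
  then show thesis by (rule that[OF right_next_dart[OF f]])
qed

lemma lake_exists:
  assumes "has_discriminant T (m\<^sup>2)"
  obtains e where "e \<in> darts T" "label T (left_region T e) = 0"
proof -
  obtain d where d: "d \<in> darts T" by (rule darts_nonempty)
  obtain a b c where abc: "config T d = (a, b, c)" by (cases "config T d")
  have disc: "b\<^sup>2 - 4 * a * c = m\<^sup>2"
    using config_discriminant[OF assms d abc] .
  show thesis
  proof (cases "a = 0 \<or> c = 0")
    case True
    then show thesis
      using that[of d] that[of "prod.swap d"] d abc by (auto simp: config_def)
  next
    case False
    \<comment> \<open>The root \<open>(m - b) / (2 a)\<close> of the quadratic, to be reduced to
      lowest terms \<open>p / q\<close>.\<close>
    define g where "g = gcd (m - b) (2 * a)"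
    have "g \<noteq> 0" using False by (simp add: g_def)
    then obtain p q where "m - b = p * g" "2 * a = q * g" "coprime p q"
      using gcd_coprime_exists[of "m - b" "2 * a"] unfolding g_def by blast
    then have pq: "m - b = g * p" "2 * a = g * q" "coprime p q"
      unfolding mult.commute[of g] .
    have "m \<noteq> b" using disc False by auto
    then have nz: "p \<noteq> 0" "q \<noteq> 0" using pq False by auto
    have "g\<^sup>2 * (a * p\<^sup>2 + b * p * q + c * q\<^sup>2) =
        a * (g * p)\<^sup>2 + b * (g * p) * (g * q) + c * (g * q)\<^sup>2"
      by (simp add: power2_eq_square algebra_simps)
    also have "\<dots> = a * (m\<^sup>2 - (b\<^sup>2 - 4 * a * c))"
      unfolding pq(1,2)[symmetric] by (simp add: power2_eq_square algebra_simps)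
    finally have zero: "a * p\<^sup>2 + b * p * q + c * q\<^sup>2 = 0"
      using disc \<open>g \<noteq> 0\<close> by simp
    show thesis
    \<comment> \<open>Words reach only vectors with positive entries. A zero with
      \<open>p q < 0\<close> lies beyond the reversed dart, whose form is
      \<open>c x^2 - b x y + a y^2\<close>.\<close>
    proof (cases "p * q > 0")
      case True
      then have "\<bar>p\<bar> * \<bar>q\<bar> = p * q" by (simp flip: abs_mult)
      then have "a * \<bar>p\<bar>\<^sup>2 + b * \<bar>p\<bar> * \<bar>q\<bar> + c * \<bar>q\<bar>\<^sup>2 = 0"
        using zero by (simp add: mult.assoc)
      then show thesis
        by (rule isotropic_region[OF d abc, rotated 3]) (use pq(3) nz that in simp_all)
    next
      case False
      then have "p * q < 0" using nz by (simp add: not_less order_less_le)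
      then have "\<bar>q\<bar> * \<bar>p\<bar> = - (p * q)" by (simp add: mult.commute flip: abs_mult)
      then have "c * \<bar>q\<bar>\<^sup>2 + (- b) * \<bar>q\<bar> * \<bar>p\<bar> + a * \<bar>p\<bar>\<^sup>2 = 0"
        using zero by (simp add: mult.assoc)
      then show thesis
        by (rule isotropic_region[of "prod.swap d" c "- b" a, rotated 5])
          (use d abc pq(3) nz that in \<open>simp_all add: coprime_commute\<close>)
    qed
  qed
qed

text \<open>Each left turn along the shore adds \<open>b\<close> to the label on the right; going
  back along the shore gives negative \<open>n\<close>.\<close>

lemma around_lake:
  assumes "e \<in> darts T" "config T e = (0, b, c)"
  shows "\<exists>f\<in>darts T. config T f = (0, b, c + n * b)"
proof (induction n rule: int_induct[of _ 0])
  case base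
  then show ?case using assms by auto
next
  case (step1 n)
  then obtain f where "f \<in> darts T" "config T f = (0, b, c + n * b)" by blast
  then show ?case by (intro bexI[of _ "left_next T f"]) (simp_all add: algebra_simps)
next
  case (step2 n)
  then obtain f where f: "f \<in> darts T" "config T f = (0, b, c + n * b)" by blast
  then obtain g where g: "g \<in> darts T" "left_next T g = f" by (metis left_next_surj)
  then have "config_left (config T g) = (0, b, c + n * b)" using f by (metis config_left_next)
  then have "config T g = (0, b, c + (n - 1) * b)"
    by (cases "config T g") (simp add: algebra_simps)
  with g show ?case by blast
qed

end

context primitive_tree
begin

text \<open>The labels around a lake run through a residue class modulo \<open>b\<close>. Its
  members \<open>r\<close> and \<open>r - b\<close> are neighbours on either side of 0, unless 0
  itself occurs; then all labels would be multiples of \<open>b\<close>, although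
  \<open>\<bar>b\<bar> \<ge> 2\<close>.\<close>

lemma river_end:
  assumes "has_discriminant T (m\<^sup>2)" "m\<^sup>2 \<ge> 4"
  obtains d a c where "d \<in> darts T" "config T d = (a, a + c, c)" "a * c < 0"
proof -
  obtain e where e: "e \<in> darts T" "label T (left_region T e) = 0"
    using lake_exists[OF assms(1)] .
  then obtain b c where bc: "config T e = (0, b, c)"
    by (simp add: config_def)
  have "b\<^sup>2 = m\<^sup>2" using config_discriminant[OF assms(1) e(1) bc] by simp
  then have b: "b \<noteq> 0" "\<bar>b\<bar> \<noteq> 1" using assms(2) by (auto simp: abs_if split: if_splits)
  define r where "r = c mod b"
  have r: "r = c + - (c div b) * b" "r - b = c + (- (c div b) - 1) * b"
    by (simp_all add: r_def minus_div_mult_eq_mod[symmetric] algebra_simps)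
  have "r \<noteq> 0"
  proof
    assume "r = 0"
    then obtain f where "f \<in> darts T" "config T f = (0, b, 0)"
      using around_lake[OF e(1) bc, of "- (c div b)"] r by auto
    then show False
      using config_scale_imp_unit[of f b "(0, 1, 0)"] b by simp
  qed
  have sign: "r * (r - b) < 0"
  proof (cases "b > 0")
    case True
    then have "r > 0" "r - b < 0" using \<open>r \<noteq> 0\<close> pos_mod_sign[of b c] pos_mod_bound[of b c]
      unfolding r_def by linarith+
    then show ?thesis by (rule mult_pos_neg)
  next
    case False
    then have "r < 0" "r - b > 0"
      using \<open>r \<noteq> 0\<close> b(1) neg_mod_sign[of b c] neg_mod_bound[of b c]
      unfolding r_def by linarith+
    then show ?thesis by (rule mult_neg_pos)
  qed
  obtain f where f: "f \<in> darts T" "config T f = (0, b, r - b)"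
    using around_lake[OF e(1) bc, of "- (c div b) - 1"] r by auto
  \<comment> \<open>This dart leaves the shore between the regions labelled \<open>r\<close> and
    \<open>r - b\<close>, with the lake behind it.\<close>
  then have "config T (right_next T f) = (r, r + (r - b), r - b)" by simp
  then show thesis by (rule that[OF right_next_dart[OF f(1)]]) (rule sign)
qed

text \<open>The gcd of \<open>a\<close> and \<open>c\<close> divides the whole configuration and so
  is 1. The sign \<open>k = - 1\<close> serves a river entered at its downstream end.\<close>

lemma config_source:
  assumes "d \<in> darts T" "config T d = config_scale k (a, a + c, c)" "\<bar>k\<bar> = 1" "a > 0" "c < 0"
  obtains w where "w \<in> lists {0, 1}" "config T d = config_scale k (source_config w)"
proof -
  define g where "g = gcd a (- c)"
  have "g > 0" using assms(4) by (simp add: g_def)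
  then obtain p q where "a = q * g" "- c = p * g" "coprime q p"
    using gcd_coprime_exists[of a "- c"] unfolding g_def by (metis less_irrefl)
  then have pq: "a = g * q" "- c = g * p" "coprime q p"
    unfolding mult.commute[of g] .
  have "g * p > 0" "g * q > 0" using pq(1,2) assms(4,5) by linarith+
  then have pos: "p > 0" "q > 0" using \<open>g > 0\<close> by (simp_all add: zero_less_mult_iff)
  then obtain w where w: "w \<in> lists {0, 1}" "lake_vector w = (p, q)"
    using lake_vector_surj pq(3) by (metis coprime_commute)
  have "c = - (g * p)" using pq by simp
  then have "config T d = config_scale (k * g) (source_config w)"
    using assms(2) pq(1) w(2) by (simp add: source_config_def algebra_simps)
  moreover from config_scale_imp_unit[OF assms(1) this] have "g = 1"
    using assms(3) \<open>g > 0\<close> by (simp add: abs_mult)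
  ultimately show thesis using that w by simp
qed

theorem river_sequence_exists:
  assumes "has_discriminant T (m\<^sup>2)" "m\<^sup>2 \<ge> 4"
  obtains w where "is_river_sequence T w"
proof -
  have scale1: "config_scale 1 s = s" for s by (cases s) simp
  have source: "\<exists>w. is_river_sequence T w"
    if d: "d \<in> darts T" "config T d = (a, a + c, c)" "a > 0" "c < 0" for d a c
  proof -
    obtain w where "w \<in> lists {0, 1}" "config T d = config_scale 1 (source_config w)"
      by (rule config_source[of d 1 a c]) (use d in \<open>simp_all add: scale1\<close>)
    with d(1) show ?thesis unfolding is_river_sequence_iff scale1 by blast
  qed
  obtain d a c where d: "d \<in> darts T" "config T d = (a, a + c, c)" "a * c < 0"
    by (rule river_end[OF assms])
  then consider "a > 0" "c < 0" | "a < 0" "c > 0" by (auto simp: mult_less_0_iff)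
  then show thesis
  proof cases
    case 1
    then show thesis using source d that by blast
  next
    case 2
    \<comment> \<open>The negative region is on the left, so \<open>d\<close> points upstream.
      Running to the other lake and reversing the dart reached there gives the first river
      dart.\<close>
    obtain w where w: "w \<in> lists {0, 1}" "config T d = config_scale (- 1) (source_config w)"
      by (rule config_source[of d "- 1" "- a" "- c"]) (use d 2 in simp_all)
    obtain r s where rs: "r > 0" "s > 0" "config_run (source_config w) w = (r, s - r, - s)"
      by (rule config_run_source[OF w(1)])
    define f where "f = last (follow d w)"
    have f: "f \<in> darts T"
      using follow_darts[OF d(1), of w] last_in_set[of "follow d w"] by (auto simp: f_def)
    have "config T f = (- r, r - s, s)"
      using config_last_follow[OF d(1), of w] rs(3) w(2) by (simp add: f_def config_run_scale)
    then have "config T (prod.swap f) = (s, s + (- r), - r)"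
      using f by simp
    then show thesis using source[of "prod.swap f" s "- r"] f rs that by auto
  qed
qed

end

section \<open>Existence of topographs\<close>

text \<open>A model of the plane cubic tree: the Cayley graph of the free product of three groups of
  order 2, the edges at every vertex being in the cyclic order of the three generators.\<close>

locale cayley_tree =
  fixes V :: "'v set" and nb :: "nat \<Rightarrow> 'v \<Rightarrow> 'v" and depth :: "'v \<Rightarrow> nat" and root :: 'v
  assumes root: "root \<in> V"
    and nb_in: "v \<in> V \<Longrightarrow> k < 3 \<Longrightarrow> nb k v \<in> V"
    and nb_nb: "v \<in> V \<Longrightarrow> k < 3 \<Longrightarrow> nb k (nb k v) = v"
    and depth_nb: "v \<in> V \<Longrightarrow> k < 3 \<Longrightarrow>
      depth (nb k v) = Suc (depth v) \<or> depth v = Suc (depth (nb k v))"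
    and parent_unique: "v \<in> V \<Longrightarrow> j < 3 \<Longrightarrow> k < 3 \<Longrightarrow> depth (nb j v) < depth v \<Longrightarrow>
      depth (nb k v) < depth v \<Longrightarrow> j = k"
    and parent_exists: "v \<in> V \<Longrightarrow> v \<noteq> root \<Longrightarrow> \<exists>k<3. depth (nb k v) < depth v"
begin

text \<open>Two parallel edges would both lead from the deeper endpoint to its parent.\<close>

lemma nb_inj: "v \<in> V \<Longrightarrow> j < 3 \<Longrightarrow> k < 3 \<Longrightarrow> nb j v = nb k v \<Longrightarrow> j = k"
  using depth_nb[of v j] parent_unique[of v j k] parent_unique[of "nb j v" j k] nb_in[of v j]
    nb_nb[of v j] nb_nb[of v k] by auto

definition graph :: "'v pair_pre_digraph" where
  "graph = \<lparr> pverts = V, parcs = {(v, nb k v) | v k. v \<in> V \<and> k < 3} \<rparr>"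

definition rot :: "'v \<times> 'v \<Rightarrow> 'v \<times> 'v" where
  "rot d = (fst d, nb ((Suc (THE k. k < 3 \<and> snd d = nb k (fst d))) mod 3) (fst d))"

lemma graph_simps [simp]:
  "pverts graph = V" "parcs graph = {(v, nb k v) | v k. v \<in> V \<and> k < 3}"
  by (simp_all add: graph_def)

lemma rot_nb: "v \<in> V \<Longrightarrow> k < 3 \<Longrightarrow> rot (v, nb k v) = (v, nb (Suc k mod 3) v)"
  unfolding rot_def by (subst the_equality[where a = k]) (use nb_inj in auto)

lemma bidirected: "pair_bidirected_digraph graph"
proof
  fix e assume "e \<in> parcs graph"
  then obtain v k where e: "e = (v, nb k v)" "v \<in> V" "k < 3" by auto
  then show "fst e \<in> pverts graph" "snd e \<in> pverts graph" "fst e \<noteq> snd e"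
    using nb_in[of v k] depth_nb[of v k] by auto
next
  show "symmetric (with_proj graph)"
    unfolding symmetric_def
  proof (rule symI)
    fix u v assume "u \<rightarrow>\<^bsub>with_proj graph\<^esub> v"
    then obtain k where "v = nb k u" "u \<in> V" "k < 3" by auto
    then have "v \<in> V" "u = nb k v" using nb_in nb_nb by auto
    with \<open>k < 3\<close> show "v \<rightarrow>\<^bsub>with_proj graph\<^esub> u" by auto
  qed
qed

lemma connected_graph: "connected (with_proj graph)"
proof -
  interpret pair_bidirected_digraph graph by (rule bidirected)
  have down: "v \<rightarrow>\<^sup>*\<^bsub>with_proj graph\<^esub> root" if "v \<in> V" for v
    using that
  proof (induction "depth v" arbitrary: v rule: less_induct)
    case less
    show ?case
    proof (cases "v = root")
      case False
      then obtain k where k: "k < 3" "depth (nb k v) < depth v"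
        using parent_exists less.prems by blast
      have "v \<rightarrow>\<^bsub>with_proj graph\<^esub> nb k v" using k less.prems by auto
      moreover have "nb k v \<rightarrow>\<^sup>*\<^bsub>with_proj graph\<^esub> root"
        using k less nb_in by blast
      ultimately show ?thesis using adj_reachable_trans by simp
    qed (use less.prems in simp)
  qed
  have "strongly_connected (with_proj graph)"
  proof
    show "verts (with_proj graph) \<noteq> {}" using root by auto
    fix u v assume "u \<in> verts (with_proj graph)" "v \<in> verts (with_proj graph)"
    then have "u \<rightarrow>\<^sup>*\<^bsub>with_proj graph\<^esub> root" "root \<rightarrow>\<^sup>*\<^bsub>with_proj graph\<^esub> v"
      using down symmetric_reachable[OF pair_sym_arcs] by simp_all
    then show "u \<rightarrow>\<^sup>*\<^bsub>with_proj graph\<^esub> v" by (rule reachable_trans)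
  qed
  then show ?thesis
    unfolding connected_def strongly_connected_def
    using reachable_mk_symmetricI by simp
qed

text \<open>At a deepest vertex of a cycle both neighbours on the cycle are its parent.\<close>

lemma cycle_short:
  assumes "pre_digraph.cycle (with_proj graph) p"
  shows "length p < 3"
proof (rule ccontr)
  interpret pair_bidirected_digraph graph by (rule bidirected)
  assume "\<not> length p < 3"
  define n where "n = length p"
  have n: "n \<ge> 3" "p \<noteq> []" using \<open>\<not> length p < 3\<close> by (auto simp: n_def)
  from assms obtain u where u: "awalk u p u" "distinct (tl (pawalk_verts u p))"
    by (auto simp: cycle_def)
  have verts: "pawalk_verts u p = map fst p @ [snd (last p)]"
    "pawalk_verts u p = fst (hd p) # map snd p"
    using awalk_verts_conv[of u p] awalk_verts_conv'[of u p u] n u(1) by (auto simp: awalk_def)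
  have dist: "distinct (map snd p)" using u(2) by (simp add: verts(2))
  have ends: "fst (hd p) = u" "snd (last p) = u"
    using u(1) verts awends_of_awalk(1,2)[of u p u] by (auto simp: last_map hd_map n)
  define nx where "nx i = Suc i mod n" for i
  have nx: "nx i < n" for i using n by (simp add: nx_def)
  have adj: "snd (p ! i) = fst (p ! nx i)" if "i < n" for i
  proof (cases "Suc i < n")
    case True
    have "(map fst p @ [snd (last p)]) ! Suc i = (fst (hd p) # map snd p) ! Suc i"
      using verts by simp
    then show ?thesis using True by (simp add: nth_append nx_def n_def)
  next
    case False
    then have "Suc i = n" using that by simp
    then have "i = length p - 1" by (simp add: n_def)
    then have "p ! i = last p" "p ! nx i = hd p"
      using n \<open>Suc i = n\<close> by (auto simp: nx_def last_conv_nth hd_conv_nth n_def)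
    then show ?thesis using ends by simp
  qed
  obtain i where i: "i < n" "\<And>j. j < n \<Longrightarrow> depth (snd (p ! j)) \<le> depth (snd (p ! nx i))"
  proof -
    let ?M = "Max ((\<lambda>j. depth (snd (p ! j))) ` {..<n})"
    have "?M \<in> (\<lambda>j. depth (snd (p ! j))) ` {..<n}"
      using n by (intro Max_in) (auto simp: lessThan_empty_iff)
    then obtain j where j: "j < n" "?M = depth (snd (p ! j))" by auto
    have le: "depth (snd (p ! k)) \<le> ?M" if "k < n" for k
      using that by (intro Max_ge) auto
    \<comment> \<open>The cyclic predecessor of the deepest position; adding \<open>n - 1\<close>
      stays clear of truncated subtraction at 0.\<close>
    define i where "i = (j + (n - 1)) mod n"
    have "nx i = j" using j(1) n by (simp add: nx_def i_def mod_Suc_eq)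
    moreover have "i < n" using n by (simp add: i_def)
    ultimately show thesis using that le j(2) by simp
  qed
  define v where "v = snd (p ! nx i)"
  have arc: "p ! j \<in> parcs graph" if "j < n" for j
    using u(1) nth_mem that unfolding awalk_def n_def by blast
  from arc[OF nx[of i]] obtain k where k: "k < 3" "fst (p ! nx i) \<in> V" "v = nb k (fst (p ! nx i))"
    by (auto simp: v_def)
  from arc[OF nx[of "nx i"]] obtain l where l: "l < 3" "v \<in> V" "snd (p ! nx (nx i)) = nb l v"
    using adj[OF nx[of i]] by (auto simp: v_def)
  have x: "nb k v = snd (p ! i)" using k nb_nb adj[OF i(1)] by simp
  have "depth (nb k v) \<le> depth v" "depth (nb l v) \<le> depth v"
    using i(2)[OF i(1)] i(2)[OF nx[of "nx i"]] l(3) x by (simp_all add: v_def)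
  then have "depth (nb k v) < depth v" "depth (nb l v) < depth v"
    using depth_nb[OF l(2) k(1)] depth_nb[OF l(2) l(1)] by auto
  then have "k = l" using parent_unique l k by blast
  then have "snd (p ! i) = snd (p ! nx (nx i))" using x l by simp
  then have "i = nx (nx i)"
    using dist i(1) nx[of "nx i"] by (simp add: distinct_conv_nth n_def) metis
  \<comment> \<open>Impossible for \<open>n \<ge> 3\<close>: this is where the length bound on
    cycles enters.\<close>
  then have "i = Suc (Suc i) mod n" by (simp add: nx_def mod_Suc_eq)
  moreover have "Suc (Suc i) mod n = (if Suc (Suc i) < n then Suc (Suc i) else Suc (Suc i) - n)"
    using i(1) n by (auto simp: mod_if)
  ultimately show False using n i(1) by (auto split: if_splits)
qed

lemma out_arcs_graph:
  assumes "v \<in> V"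
  shows "out_arcs (with_proj graph) v = (\<lambda>k. (v, nb k v)) ` {..<3}"
  using assms by (auto simp: out_arcs_def)

lemma cyclic_rot:
  assumes "v \<in> V"
  shows "cyclic_on rot (out_arcs (with_proj graph) v)"
proof (rule cyclic_on_singleI)
  let ?s = "(v, nb 0 v)"
  have pow: "(rot ^^ m) ?s = (v, nb (m mod 3) v)" for m
    using assms by (induction m) (simp_all add: rot_nb mod_Suc_eq)
  show "?s \<in> out_arcs (with_proj graph) v"
    using assms by (auto simp: out_arcs_graph)
  have "(rot ^^ 3) ?s = ?s" by (simp only: pow) simp
  then have "orbit rot ?s = {(rot ^^ m) ?s | m. m < 3}"
    by (rule orbit_altdef_bounded) simp
  also have "\<dots> = (\<lambda>m. (rot ^^ m) ?s) ` {..<3}" by auto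
  also have "\<dots> = (\<lambda>k. (v, nb k v)) ` {..<3}"
    by (rule image_cong) (simp_all add: pow)
  finally show "out_arcs (with_proj graph) v = orbit rot ?s"
    using assms by (simp add: out_arcs_graph)
qed

theorem plane_cubic_tree_graph: "plane_cubic_tree \<lparr> skel = graph, cw = rot, label = l \<rparr>"
proof -
  have "out_degree (with_proj graph) v = 3" if "v \<in> V" for v
    unfolding out_degree_def out_arcs_graph[OF that]
    by (subst card_image) (auto simp: inj_on_def dest: nb_inj[OF that])
  then show ?thesis
    using bidirected connected_graph cycle_short cyclic_rot
    by (simp add: plane_cubic_tree_def cubic_tree_def)
qed

end

definition reduced_words :: "nat list set" where
  "reduced_words = {w. set w \<subseteq> {..<3} \<and> distinct_adj w}"

text \<open>Left multiplication by the involution \<open>k\<close>. Since it acts at the head, the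
  parent of a nonempty word is its tail and the depth is the length.\<close>

definition word_nb :: "nat \<Rightarrow> nat list \<Rightarrow> nat list" where
  "word_nb k w = (if w \<noteq> [] \<and> hd w = k then tl w else k # w)"

text \<open>The injection \<open>f\<close> transports the model into the vertex type of the theorem,
  which is merely known to be infinite.\<close>

lemma cayley_tree_words:
  fixes f :: "nat list \<Rightarrow> 'v"
  assumes "inj f"
  shows "cayley_tree (f ` reduced_words) (\<lambda>k v. f (word_nb k (inv f v)))
    (\<lambda>v. length (inv f v)) (f [])"
proof
  note [simp] = inv_f_f[OF assms] inj_eq[OF assms]
  note defs = reduced_words_def word_nb_def
  show "f [] \<in> f ` reduced_words" by (simp add: defs)
  fix v assume "v \<in> f ` reduced_words"
  then obtain w where w: "v = f w" "w \<in> reduced_words" by blast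
  show "\<exists>k<3. length (inv f (f (word_nb k (inv f v)))) < length (inv f v)" if "v \<noteq> f []"
    using that w by (cases w) (auto simp: defs)
  fix k :: nat assume k: "k < 3"
  show "f (word_nb k (inv f v)) \<in> f ` reduced_words"
    using w k by (cases w) (auto simp: defs distinct_adj_Cons)
  show "f (word_nb k (inv f (f (word_nb k (inv f v))))) = v"
    using w k by (cases w) (auto simp: defs distinct_adj_Cons)
  show "length (inv f (f (word_nb k (inv f v)))) = Suc (length (inv f v)) \<or>
    length (inv f v) = Suc (length (inv f (f (word_nb k (inv f v)))))"
    using w k by (cases w) (auto simp: defs)
  fix j :: nat assume "j < 3" "length (inv f (f (word_nb j (inv f v)))) < length (inv f v)"
    "length (inv f (f (word_nb k (inv f v)))) < length (inv f v)"
  then show "j = k" using w by (cases w) (auto simp: defs split: if_splits)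
qed

lemma plane_cubic_tree_exists:
  assumes "infinite (UNIV :: 'v set)"
  obtains T :: "'v topograph" where "plane_cubic_tree T"
proof -
  obtain g :: "nat \<Rightarrow> 'v" where "inj g"
    using infinite_countable_subset[OF assms] by auto
  then have "inj (g \<circ> to_nat :: nat list \<Rightarrow> 'v)" by (simp add: inj_compose)
  then show thesis
    using cayley_tree.plane_cubic_tree_graph[OF cayley_tree_words] that by blast
qed

theorem topograph_exists:
  assumes "infinite (UNIV :: 'v set)"
  obtains T :: "'v topograph" and d where "is_topograph T" "d \<in> darts T" "config T d = s"
proof -
  obtain T0 :: "'v topograph" where "plane_cubic_tree T0"
    using plane_cubic_tree_exists[OF assms] .
  then interpret T0: plane_tree T0 by unfold_locales
  obtain d0 where d0: "d0 \<in> darts T0" by (rule T0.darts_nonempty)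
  obtain h where h: "h d0 = s"
    "\<And>d. d \<in> darts T0 \<Longrightarrow> h (prod.swap d) = config_swap (h d)"
    "\<And>d. d \<in> darts T0 \<Longrightarrow> h (left_next T0 d) = config_left (h d)"
    "\<And>d. d \<in> darts T0 \<Longrightarrow> h (right_next T0 d) = config_right (h d)"
    by (rule T0.config_labelling[OF d0, of s]) blast
  \<comment> \<open>Reading the label off an arbitrary dart of the region is sound because the first
    entry of \<open>h\<close> is constant on regions.\<close>
  define T where "T = T0\<lparr>label := \<lambda>R. fst (h (SOME d. d \<in> R))\<rparr>"
  have skel: "skel T = skel T0" and cw: "cw T = cw T0" by (simp_all add: T_def)
  have next_eq: "left_next T = left_next T0" "right_next T = right_next T0"
    by (simp_all add: fun_eq_iff left_next_def right_next_def cw)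
  have "plane_cubic_tree T"
    using T0.plane by (simp add: plane_cubic_tree_def skel cw)
  then interpret T: plane_tree T by unfold_locales
  have left: "label T (left_region T d) = fst (h d)" if "d \<in> darts T" for d
  proof -
    have "(SOME e. e \<in> left_region T d) \<in> left_region T d"
      using T.left_region_self by (rule someI)
    then have "left_region T (SOME e. e \<in> left_region T d) = left_region T d"
      by (rule T.left_region_eqI)
    from T.config_labelling_region[of d _ h, OF that this[symmetric]] show ?thesis
      using h(3) by (simp add: next_eq skel) (simp add: T_def)
  qed
  have swap: "h (prod.swap d) = config_swap (h d)"
    and right: "h (right_next T d) = config_right (h d)" if "d \<in> darts T" for d
    using h(2,4) that by (simp_all add: skel next_eq)
  have labels: "label T (left_region T d) = a" "label T (right_region T d) = c"
    "label T (ahead_region T d) = a + b + c" "label T (behind_region T d) = a - b + c"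
    if d: "d \<in> darts T" "h d = (a, b, c)" for d a b c
    using left[of d] left[of "prod.swap d"] left[of "right_next T d"]
      left[of "right_next T (prod.swap d)"] swap[OF d(1)] right[OF d(1)] right[of "prod.swap d"] d
    by simp_all
  have "is_topograph T"
    unfolding is_topograph_def
  proof (intro conjI ballI T.plane)
    fix d assume d: "d \<in> darts T"
    obtain a b c where "h d = (a, b, c)" by (cases "h d")
    from labels[OF d this]
    show "label T (behind_region T d) + label T (ahead_region T d) =
      2 * (label T (left_region T d) + label T (right_region T d))" by simp
  qed
  moreover have "config T d0 = s"
  proof -
    obtain a b c where "s = (a, b, c)" by (cases s)
    with labels[of d0 a b c] d0 h(1) show ?thesis
      by (simp add: skel config_def edge_label_def)
  qed
  ultimately show thesis using that d0 by (simp add: skel)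
qed

section \<open>The bijection\<close>

lemma square_topographD:
  assumes "T \<in> square_topographs"
  obtains m where "primitive_tree T" "has_discriminant T (m\<^sup>2)" "m\<^sup>2 \<ge> 4"
  using assms that
  by (auto simp: square_topographs_def primitive_topograph_def primitive_tree_def
      topograph_tree_def primitive_tree_axioms_def)

lemma ex1_river_sequence:
  assumes "T \<in> square_topographs"
  shows "\<exists>!w. is_river_sequence T w"
proof -
  obtain m where T: "primitive_tree T" "has_discriminant T (m\<^sup>2)" "m\<^sup>2 \<ge> 4"
    using square_topographD[OF assms] .
  interpret primitive_tree T by fact
  show ?thesis
    using river_sequence_exists[OF T(2,3)] river_sequence_unique by metis
qed

lemma river_sequence_eq_iff:
  assumes "T \<in> square_topographs"
  shows "river_sequence T = w \<longleftrightarrow>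
    w \<in> lists {0, 1} \<and> (\<exists>d\<in>darts T. config T d = source_config w)"
proof -
  interpret primitive_tree T using square_topographD[OF assms] .
  have "river_sequence T = w \<longleftrightarrow> is_river_sequence T w"
    using ex1_river_sequence[OF assms] unfolding river_sequence_def by (metis theI')
  then show ?thesis using is_river_sequence_iff by simp
qed

text \<open>Isomorphic topographs have the same configurations, in particular the same source
  configuration; conversely, one shared configuration already yields an isomorphism.\<close>

lemma topograph_iso_iff_river_sequence:
  fixes S T :: "'v topograph"
  assumes S: "S \<in> square_topographs" and T: "T \<in> square_topographs"
  shows "topograph_iso S T \<longleftrightarrow> river_sequence S = river_sequence T"
proof -
  have top: "is_topograph S" "is_topograph T"
    using assms by (auto simp: square_topographs_def primitive_topograph_def)
  obtain d where d: "river_sequence S \<in> lists {0, 1}" "d \<in> darts S"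
    "config S d = source_config (river_sequence S)"
    using river_sequence_eq_iff[OF S, of "river_sequence S"] by blast
  show ?thesis
  proof
    assume "topograph_iso S T"
    then obtain e where "e \<in> darts T" "config T e = config S d"
      using iso_imp_config[OF top _ d(2)] by blast
    then have "river_sequence T = river_sequence S"
      using river_sequence_eq_iff[OF T] d(1,3) by metis
    then show "river_sequence S = river_sequence T" by simp
  next
    assume "river_sequence S = river_sequence T"
    then obtain e where "e \<in> darts T" "config T e = source_config (river_sequence S)"
      using river_sequence_eq_iff[OF T, of "river_sequence T"] by metis
    then show "topograph_iso S T"
      using config_eq_imp_iso[OF top d(2)] d(3) by metis
  qed
qed

text \<open>Put the source configuration of \<open>w\<close> at a dart. Its labels \<open>q\<close>
  and \<open>- p\<close> are coprime, so the topograph is primitive, and positivity of both gives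
  \<open>(p + q)^2 \<ge> 4\<close>.\<close>

lemma river_sequence_surj:
  assumes "infinite (UNIV :: 'v set)" "w \<in> lists {0, 1}"
  obtains T :: "'v topograph" where "T \<in> square_topographs" "river_sequence T = w"
proof -
  obtain p q where pq: "lake_vector w = (p, q)" by fastforce
  note pos = lake_vector_pos[OF pq]
  obtain T :: "'v topograph" and d where T: "is_topograph T" and d: "d \<in> darts T"
    and conf: "config T d = source_config w"
    by (rule topograph_exists[OF assms(1), of "source_config w"]) blast
  interpret topograph_tree T using T by unfold_locales
  have config_d: "config T d = (q, q - p, - p)"
    using conf pq by (simp add: source_config_def)
  have "Gcd (label T ` regions T) dvd label T (left_region T e)" if "e \<in> darts T" for e
    using that by (intro Gcd_dvd) (simp add: regions_def)
  from this[OF d] this[of "prod.swap d"]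
  have "Gcd (label T ` regions T) dvd q" "Gcd (label T ` regions T) dvd p"
    using config_d d by (simp_all add: config_def)
  then have "is_unit (Gcd (label T ` regions T))"
    using coprime_lake_vector[OF pq] coprime_common_divisor by blast
  then have "primitive_topograph T"
    using T is_unit_normalize[of "Gcd (label T ` regions T)"]
    by (simp add: primitive_topograph_def)
  moreover have "has_discriminant T ((p + q)\<^sup>2)"
    using has_discriminantI[OF d config_d] by (simp add: power2_eq_square algebra_simps)
  moreover have "(p + q)\<^sup>2 \<ge> 2\<^sup>2"
    using pos by (intro power_mono) auto
  ultimately have "T \<in> square_topographs"
    by (auto simp: square_topographs_def)
  then show thesis
    using that river_sequence_eq_iff assms(2) d conf by blast
qed

theorem theorem8p15:
  assumes "infinite (UNIV :: 'v set)"
  shows "(\<forall>T \<in> (square_topographs :: 'v topograph set). \<exists>!w. is_river_sequence T w) \<and>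
    equiv (square_topographs :: 'v topograph set) square_topograph_iso \<and>
    river_sequence respects (square_topograph_iso :: ('v topograph \<times> 'v topograph) set) \<and>
    bij_betw (\<lambda>C. the_elem (river_sequence ` C))
      ((square_topographs :: 'v topograph set) // square_topograph_iso)
      (lists {0, 1})"
proof (intro conjI ballI ex1_river_sequence)
  let ?X = "square_topographs :: 'v topograph set"
  \<comment> \<open>Isomorphism is the kernel of \<open>river_sequence\<close>, so equivalence,
    well-definedness and injectivity become formal.\<close>
  have iso: "square_topograph_iso =
    {(S, T). S \<in> ?X \<and> T \<in> ?X \<and> river_sequence S = river_sequence T}"
    using topograph_iso_iff_river_sequence by (auto simp: square_topograph_iso_def)
  show equiv: "equiv ?X square_topograph_iso"
    by (auto simp: iso equiv_def refl_on_def sym_def trans_def)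
  show respects: "river_sequence respects (square_topograph_iso :: ('v topograph \<times> 'v topograph) set)"
    by (auto simp: iso congruent_def)
  have the_elem: "the_elem (river_sequence ` (square_topograph_iso `` {T})) = river_sequence T"
    if "T \<in> ?X" for T
  proof -
    have "river_sequence ` (square_topograph_iso `` {T}) = {river_sequence T}"
      using that by (auto simp: iso)
    then show ?thesis by simp
  qed
  show "bij_betw (\<lambda>C. the_elem (river_sequence ` C)) (?X // square_topograph_iso) (lists {0, 1})"
    unfolding bij_betw_def
  proof
    show "inj_on (\<lambda>C. the_elem (river_sequence ` C)) (?X // square_topograph_iso)"
    proof (rule inj_onI)
      fix C C' assume C: "C \<in> ?X // square_topograph_iso" "C' \<in> ?X // square_topograph_iso"
        and eq: "the_elem (river_sequence ` C) = the_elem (river_sequence ` C')"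
      obtain S T where ST: "S \<in> ?X" "C = square_topograph_iso `` {S}"
        "T \<in> ?X" "C' = square_topograph_iso `` {T}"
        using C by (metis quotientE)
      then have "(S, T) \<in> square_topograph_iso"
        using eq by (simp add: the_elem) (simp add: iso)
      with ST show "C = C'" using equiv_class_eq[OF equiv] by simp
    qed
    show "(\<lambda>C. the_elem (river_sequence ` C)) ` (?X // square_topograph_iso) = lists {0, 1}"
    proof (intro equalityI subsetI)
      fix w assume "w \<in> (\<lambda>C. the_elem (river_sequence ` C)) ` (?X // square_topograph_iso)"
      then obtain T where "T \<in> ?X" "w = river_sequence T"
        by (auto elim!: quotientE simp: the_elem)
      then show "w \<in> lists {0, 1}" using river_sequence_eq_iff by blast
    next
      fix w :: "nat list" assume "w \<in> lists {0, 1}"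
      then obtain T where "T \<in> ?X" "river_sequence T = w"
        using river_sequence_surj[OF assms] by metis
      then show "w \<in> (\<lambda>C. the_elem (river_sequence ` C)) ` (?X // square_topograph_iso)"
        by (intro image_eqI[where x = "square_topograph_iso `` {T}"]) (auto simp: the_elem quotientI)
    qed
  qed
qed

end
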